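(* For each integer $\alpha \geq 5$, let \[ \Gamma_1 = \Gamma^{2^{\alpha-1}, 2^{\alpha}}(-1 + 2^{\alpha-2},\ -3 + 2^{\alpha-2},\ 1 + 2^{\alpha-2},\ 3 + 2^{\alpha-2}), \qquad \Gamma_2 = \Gamma^{2^{\alpha}, 8}(-1 + 2^{\alpha-2},\ -3,\ 1 + 2^{\alpha-2},\ 3). \] Then the mix $\Gamma_1 \diamond \Gamma_2$ is the automorphism group of a tight chiral polyhedron of type $\{2^{\alpha}, 2^{\alpha}\}$.
   Context: For integers $p,q,i_1,j_1,i_2,j_2$, $\Gamma^{p,q}(i_1,j_1,i_2,j_2)$ denotes the group with presentation $\langle \sigma_1,\sigma_2 \mid \sigma_1^p=\sigma_2^q=(\sigma_1\sigma_2)^2=1,\ \sigma_2^{-1}\sigma_1=\sigma_1^{i_1}\sigma_2^{j_1},\ \sigma_2\sigma_1^{-1}=\sigma_1^{i_2}\sigma_2^{j_2}\rangle$. For groups $\Gamma=\langle\sigma_1,\sigma_2\rangle$ and $\Gamma'=\langle\sigma_1',\sigma_2'\rangle$, the mix $\Gamma\diamond\Gamma'$ is the subgroup of $\Gamma\times\Gamma'$ generated by $\alpha_1=(\sigma_1,\sigma_1')$ and $\alpha_2=(\sigma_2,\sigma_2')$, with distinguished generators $\alpha_1,\alpha_2$. An (abstract) polyhedron is a partially ordered set whose elements have rank $0$, $1$, $2$ (vertices, edges, faces), incidence meaning comparability, such that every edge is incident to exactly two vertices and two faces, whenever a vertex is incident to a face exactly two edges are incident to both, the incidence graph is connected, and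 for each vertex or face the subgraph of the incidence graph induced on its neighbours is connected. A flag is a mutually incident (vertex, edge, face) triple; $\Phi^i$ is the flag differing from $\Phi$ exactly in its rank-$i$ element. Type $\{p,q\}$: faces are incident to $p$ edges and vertices to $q$ edges. The polyhedron is chiral if its flags split into two classes with $\Phi,\Phi^i$ always in different classes and the automorphism group transitive on each class but not on all flags; then, fixing a base flag $\Phi$, the automorphism group is generated by $\sigma_1:\Phi\mapsto(\Phi^1)^0$ and $\sigma_2:\Phi\mapsto(\Phi^2)^1$. A group with two distinguished generators "is the automorphism group of" such a polyhedron if there is an isomorphism onto it sending the distinguished generators to $\sigma_1,\sigma_2$ respectively. A polyhedron of type $\{p,q\}$ is tight if it has exactly $2pq$ flags. *)

theory Defs
  imports "HOL-Algebra.Generated_Groups" "HOL-Algebra.Bij"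
begin

section \<open>Groups given by a presentation\<close>

text \<open>
  A word is a list of letters; the letter \<open>(x, True)\<close> stands for the generator \<open>x\<close> and
  \<open>(x, False)\<close> for its inverse.
\<close>

type_synonym 'g word = "('g \<times> bool) list"

inductive word_eq :: "('g word \<times> 'g word) set \<Rightarrow> 'g word \<Rightarrow> 'g word \<Rightarrow> bool"
  for R where
  refl: "word_eq R u u"
| sym: "word_eq R u v \<Longrightarrow> word_eq R v u"
| trans: "word_eq R u v \<Longrightarrow> word_eq R v w \<Longrightarrow> word_eq R u w"
| cancel: "word_eq R (u @ [(x, b), (x, \<not> b)] @ v) (u @ v)"
| rel: "(l, r) \<in> R \<Longrightarrow> word_eq R (u @ l @ v) (u @ r @ v)"

definition word_class :: "('g word \<times> 'g word) set \<Rightarrow> 'g word \<Rightarrow> 'g word set" where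
  "word_class R u = {v. word_eq R u v}"

definition presented_group :: "('g word \<times> 'g word) set \<Rightarrow> 'g word set monoid" where
  "presented_group R =
     \<lparr>carrier = range (word_class R),
      mult = (\<lambda>A B. \<Union>u\<in>A. \<Union>v\<in>B. word_class R (u @ v)),
      one = word_class R []\<rparr>"

lemma word_class_eq_iff: "word_class R u = word_class R v \<longleftrightarrow> word_eq R u v"
  unfolding word_class_def set_eq_iff mem_Collect_eq
  by (meson word_eq.refl word_eq.sym word_eq.trans)

lemma word_eq_append_left: "word_eq R u v \<Longrightarrow> word_eq R (w @ u) (w @ v)"
proof (induction rule: word_eq.induct)
  case (cancel u x b v)
  show ?case using word_eq.cancel[of R "w @ u" x b v] by simp
next
  case (rel l r u v)
  then show ?case using word_eq.rel[of l r R "w @ u" v] by simp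
qed (rule word_eq.refl, erule word_eq.sym, erule (1) word_eq.trans)

lemma word_eq_append_right: "word_eq R u v \<Longrightarrow> word_eq R (u @ w) (v @ w)"
proof (induction rule: word_eq.induct)
  case (cancel u x b v)
  show ?case using word_eq.cancel[of R u x b "v @ w"] by simp
next
  case (rel l r u v)
  then show ?case using word_eq.rel[of l r R u "v @ w"] by simp
qed (rule word_eq.refl, erule word_eq.sym, erule (1) word_eq.trans)

lemma word_eq_append:
  "word_eq R u u' \<Longrightarrow> word_eq R v v' \<Longrightarrow> word_eq R (u @ v) (u' @ v')"
  by (rule word_eq.trans[OF word_eq_append_right word_eq_append_left])

lemma presented_group_mult:
  "word_class R u \<otimes>\<^bsub>presented_group R\<^esub> word_class R v = word_class R (u @ v)"
proof -
  have *: "word_class R (u' @ v') = word_class R (u @ v)"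
    if "u' \<in> word_class R u" "v' \<in> word_class R v" for u' v'
    using that unfolding word_class_eq_iff
    by (simp add: word_class_def word_eq_append word_eq.sym)
  have "u \<in> word_class R u" "v \<in> word_class R v"
    by (simp_all add: word_class_def word_eq.refl)
  then have "(\<Union>u'\<in>word_class R u. \<Union>v'\<in>word_class R v. word_class R (u' @ v')) = word_class R (u @ v)"
    using * by blast
  then show ?thesis by (simp add: presented_group_def)
qed

lemma word_eq_inverse:
  "word_eq R (rev (map (\<lambda>(x, b). (x, \<not> b)) u) @ u) []"
proof (induction u)
  case Nil
  show ?case by (simp add: word_eq.refl)
next
  case (Cons a u)
  obtain x b where a: "a = (x, b)" by (cases a)
  show ?case
    using word_eq.trans[OF word_eq.cancel[of R "rev (map (\<lambda>(x, b). (x, \<not> b)) u)" x "\<not> b" u]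
        Cons.IH] a by simp
qed

lemma group_presented_group: "group (presented_group R)"
proof (rule groupI)
  fix A assume "A \<in> carrier (presented_group R)"
  then obtain u where A: "A = word_class R u" by (auto simp: presented_group_def)
  show "\<exists>B\<in>carrier (presented_group R). B \<otimes>\<^bsub>presented_group R\<^esub> A = \<one>\<^bsub>presented_group R\<^esub>"
  proof (rule bexI)
    show "word_class R (rev (map (\<lambda>(x, b). (x, \<not> b)) u)) \<otimes>\<^bsub>presented_group R\<^esub> A
      = \<one>\<^bsub>presented_group R\<^esub>"
      unfolding A presented_group_mult
      by (simp add: presented_group_def word_class_eq_iff word_eq_inverse)
  qed (simp add: presented_group_def)
next
  fix A assume "A \<in> carrier (presented_group R)"
  then obtain u where A: "A = word_class R u" by (auto simp: presented_group_def)
  have one: "\<one>\<^bsub>presented_group R\<^esub> = word_class R []" by (simp add: presented_group_def)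
  show "\<one>\<^bsub>presented_group R\<^esub> \<otimes>\<^bsub>presented_group R\<^esub> A = A"
    unfolding A one presented_group_mult by simp
next
  fix A B assume "A \<in> carrier (presented_group R)" "B \<in> carrier (presented_group R)"
  then obtain u v where AB: "A = word_class R u" "B = word_class R v"
    by (auto simp: presented_group_def)
  show "A \<otimes>\<^bsub>presented_group R\<^esub> B \<in> carrier (presented_group R)"
    unfolding AB presented_group_mult by (simp add: presented_group_def)
next
  fix A B C
  assume "A \<in> carrier (presented_group R)" "B \<in> carrier (presented_group R)"
    "C \<in> carrier (presented_group R)"
  then obtain u v w where "A = word_class R u" "B = word_class R v" "C = word_class R w"
    by (auto simp: presented_group_def)
  then show "A \<otimes>\<^bsub>presented_group R\<^esub> B \<otimes>\<^bsub>presented_group R\<^esub> C =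
      A \<otimes>\<^bsub>presented_group R\<^esub> (B \<otimes>\<^bsub>presented_group R\<^esub> C)"
    by (simp add: presented_group_mult)
qed (simp add: presented_group_def)


section \<open>Groups with two distinguished generators, and their mix\<close>

type_synonym 'a gen_group = "'a monoid \<times> 'a \<times> 'a"

datatype gen = Sigma1 | Sigma2

definition gen_pow :: "'g \<Rightarrow> int \<Rightarrow> 'g word" where
  "gen_pow x k = replicate (nat \<bar>k\<bar>) (x, 0 \<le> k)"

definition Gamma_rels :: "int \<Rightarrow> int \<Rightarrow> int \<Rightarrow> int \<Rightarrow> int \<Rightarrow> int \<Rightarrow> (gen word \<times> gen word) set" where
  "Gamma_rels p q i1 j1 i2 j2 =
     {(gen_pow Sigma1 p, []),
      (gen_pow Sigma2 q, []),
      ([(Sigma1, True), (Sigma2, True), (Sigma1, True), (Sigma2, True)], []),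
      ([(Sigma2, False), (Sigma1, True)], gen_pow Sigma1 i1 @ gen_pow Sigma2 j1),
      ([(Sigma2, True), (Sigma1, False)], gen_pow Sigma1 i2 @ gen_pow Sigma2 j2)}"

definition Gamma :: "int \<Rightarrow> int \<Rightarrow> int \<Rightarrow> int \<Rightarrow> int \<Rightarrow> int \<Rightarrow> gen word set gen_group" where
  "Gamma p q i1 j1 i2 j2 =
     (let R = Gamma_rels p q i1 j1 i2 j2
      in (presented_group R, word_class R [(Sigma1, True)], word_class R [(Sigma2, True)]))"

fun mix :: "'a gen_group \<Rightarrow> 'b gen_group \<Rightarrow> ('a \<times> 'b) gen_group" (infixl "\<diamondop>" 70) where
  "(G, s1, s2) \<diamondop> (H, t1, t2) =
     (subgroup_generated (G \<times>\<times> H) {(s1, t1), (s2, t2)}, (s1, t1), (s2, t2))"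


section \<open>Abstract polyhedra\<close>

record 'a ranked_poset =
  elems :: "'a set"
  order_rel :: "'a rel"
  rank :: "'a \<Rightarrow> nat"

definition of_rank :: "'a ranked_poset \<Rightarrow> nat \<Rightarrow> 'a set" where
  "of_rank K i = {x \<in> elems K. rank K x = i}"

definition incident :: "'a ranked_poset \<Rightarrow> 'a \<Rightarrow> 'a \<Rightarrow> bool" where
  "incident K x y \<longleftrightarrow> (x, y) \<in> order_rel K \<or> (y, x) \<in> order_rel K"

definition neighbours :: "'a ranked_poset \<Rightarrow> 'a \<Rightarrow> 'a set" where
  "neighbours K x = {y \<in> elems K. y \<noteq> x \<and> incident K x y}"

text \<open>Connectedness of the subgraph of the incidence graph induced on \<open>S\<close>.\<close>

definition incidence_connected :: "'a ranked_poset \<Rightarrow> 'a set \<Rightarrow> bool" where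
  "incidence_connected K S \<longleftrightarrow>
     (\<forall>x\<in>S. \<forall>y\<in>S. (x, y) \<in> {(u, v). u \<in> S \<and> v \<in> S \<and> incident K u v}\<^sup>*)"

definition polyhedron :: "'a ranked_poset \<Rightarrow> bool" where
  "polyhedron K \<longleftrightarrow>
     partial_order_on (elems K) (order_rel K) \<and>
     elems K \<noteq> {} \<and>
     (\<forall>x\<in>elems K. rank K x \<in> {0, 1, 2}) \<and>
     (\<forall>(x, y)\<in>order_rel K. x \<noteq> y \<longrightarrow> rank K x < rank K y) \<and>
     (\<forall>e\<in>of_rank K 1. card {v \<in> of_rank K 0. incident K v e} = 2 \<and>
                      card {f \<in> of_rank K 2. incident K e f} = 2) \<and>
     (\<forall>v\<in>of_rank K 0. \<forall>f\<in>of_rank K 2. incident K v f \<longrightarrow>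
        card {e \<in> of_rank K 1. incident K v e \<and> incident K e f} = 2) \<and>
     incidence_connected K (elems K) \<and>
     (\<forall>x\<in>of_rank K 0 \<union> of_rank K 2. incidence_connected K (neighbours K x))"

definition has_type :: "'a ranked_poset \<Rightarrow> nat \<Rightarrow> nat \<Rightarrow> bool" where
  "has_type K p q \<longleftrightarrow>
     (\<forall>f\<in>of_rank K 2. finite {e \<in> of_rank K 1. incident K e f} \<and>
                      card {e \<in> of_rank K 1. incident K e f} = p) \<and>
     (\<forall>v\<in>of_rank K 0. finite {e \<in> of_rank K 1. incident K v e} \<and>
                      card {e \<in> of_rank K 1. incident K v e} = q)"

type_synonym 'a flag = "'a \<times> 'a \<times> 'a"

definition flags :: "'a ranked_poset \<Rightarrow> 'a flag set" where
  "flags K = {(v, e, f). v \<in> of_rank K 0 \<and> e \<in> of_rank K 1 \<and> f \<in> of_rank K 2 \<and>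
                         incident K v e \<and> incident K e f \<and> incident K v f}"

fun flag_elem :: "'a flag \<Rightarrow> nat \<Rightarrow> 'a" where
  "flag_elem (v, e, f) i = (if i = 0 then v else if i = 1 then e else f)"

text \<open>The flag \<open>\<Phi>\<^sup>i\<close>; it exists and is unique when \<open>K\<close> is a polyhedron, \<open>\<Phi>\<close> is a flag of \<open>K\<close>
  and \<open>i \<le> 2\<close>.\<close>

definition adj_flag :: "'a ranked_poset \<Rightarrow> nat \<Rightarrow> 'a flag \<Rightarrow> 'a flag" where
  "adj_flag K i \<Phi> =
     (THE \<Psi>. \<Psi> \<in> flags K \<and> (\<forall>j\<in>{0, 1, 2}. flag_elem \<Psi> j \<noteq> flag_elem \<Phi> j \<longleftrightarrow> j = i))"

text \<open>The product is that of automorphisms acting on the right: \<open>g \<otimes> h\<close> is \<open>g\<close> followed by \<open>h\<close>.\<close>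

definition aut_group :: "'a ranked_poset \<Rightarrow> ('a \<Rightarrow> 'a) monoid" where
  "aut_group K =
     \<lparr>carrier = {g \<in> Bij (elems K). \<forall>x\<in>elems K. \<forall>y\<in>elems K.
                   (x, y) \<in> order_rel K \<longleftrightarrow> (g x, g y) \<in> order_rel K},
      mult = (\<lambda>g h. compose (elems K) h g),
      one = (\<lambda>x\<in>elems K. x)\<rparr>"

fun flag_image :: "('a \<Rightarrow> 'a) \<Rightarrow> 'a flag \<Rightarrow> 'a flag" where
  "flag_image g (v, e, f) = (g v, g e, g f)"

definition flag_transitive_on :: "'a ranked_poset \<Rightarrow> 'a flag set \<Rightarrow> bool" where
  "flag_transitive_on K A \<longleftrightarrow>
     (\<forall>\<Phi>\<in>A. \<forall>\<Psi>\<in>A. \<exists>g\<in>carrier (aut_group K). flag_image g \<Phi> = \<Psi>)"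

definition chiral :: "'a ranked_poset \<Rightarrow> bool" where
  "chiral K \<longleftrightarrow> polyhedron K \<and>
     (\<exists>A B. A \<union> B = flags K \<and> A \<inter> B = {} \<and> A \<noteq> {} \<and> B \<noteq> {} \<and>
        (\<forall>\<Phi>\<in>flags K. \<forall>i\<in>{0, 1, 2}. \<Phi> \<in> A \<longleftrightarrow> adj_flag K i \<Phi> \<in> B) \<and>
        flag_transitive_on K A \<and> flag_transitive_on K B) \<and>
     \<not> flag_transitive_on K (flags K)"

definition tight :: "'a ranked_poset \<Rightarrow> nat \<Rightarrow> nat \<Rightarrow> bool" where
  "tight K p q \<longleftrightarrow> polyhedron K \<and> has_type K p q \<and>
     finite (flags K) \<and> card (flags K) = 2 * p * q"

text \<open>The base flag is part of the choice of \<open>\<sigma>\<^sub>1, \<sigma>\<^sub>2\<close>: the two flag classes of a chiral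
  polyhedron give inequivalent pairs of generators.\<close>

fun is_aut_group_of :: "'b gen_group \<Rightarrow> 'a ranked_poset \<Rightarrow> bool" where
  "is_aut_group_of (G, a1, a2) K \<longleftrightarrow>
     (\<exists>\<Phi>\<in>flags K. \<exists>h\<in>iso G (aut_group K).
        flag_image (h a1) \<Phi> = adj_flag K 0 (adj_flag K 1 \<Phi>) \<and>
        flag_image (h a2) \<Phi> = adj_flag K 1 (adj_flag K 2 \<Phi>))"

end

theory Submission
  imports Defs "HOL-Algebra.Multiplicative_Group" "HOL-Library.Countable_Set"
    "HOL-Number_Theory.Cong"
begin

text \<open>
  Put \<open>N = 2\<^sup>\<alpha>\<^sup>-\<^sup>2\<close>. The generators \<open>s, t\<close> of the mix satisfy
  \<open>t\<^sup>-\<^sup>1 s = s\<^sup>-\<^sup>1\<^sup>+\<^sup>N t\<^sup>-\<^sup>3\<^sup>+\<^sup>N\<close> and \<open>t s\<^sup>-\<^sup>1 = s\<^sup>1\<^sup>+\<^sup>N t\<^sup>3\<^sup>+\<^sup>N\<close>.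
  These relations force \<open>s\<^sup>N\<close> to commute with \<open>t\<^sup>6\<close>, hence with \<open>t\<^sup>2\<close>, and then every element
  is a product \<open>s\<^sup>i t\<^sup>j\<close>. The group \<open>\<Gamma>\<^sub>1\<close> acts on the integers modulo \<open>4 N\<close> with \<open>\<sigma>\<^sub>2\<close> as
  the translation by 1 and \<open>\<sigma>\<^sub>1\<close> fixing 0, and \<open>\<Gamma>\<^sub>2\<close> acts likewise with the generators
  exchanged, so \<open>s\<^sup>i = t\<^sup>j\<close> only if \<open>4 N\<close> divides both \<open>i\<close> and \<open>j\<close>. Now whenever \<open>\<langle>s\<rangle>\<close> and \<open>\<langle>t\<rangle>\<close>
  meet trivially, the right cosets of \<open>\<langle>t\<rangle>\<close>, \<open>\<langle>s t\<rangle>\<close> and \<open>\<langle>s\<rangle>\<close>, incident when they intersect,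
  are the vertices, edges and faces of a polyhedron with two flags for each group element; here it
  is tight because the group has \<open>(4 N)\<^sup>2\<close> elements. An automorphism joining the two classes of
  flags would yield an endomorphism of the group that inverts \<open>s\<close> and \<open>t\<close>; it would turn the first
  relation into \<open>t s\<^sup>-\<^sup>1 = s\<^sup>1\<^sup>-\<^sup>N t\<^sup>3\<^sup>-\<^sup>N\<close>, contradicting the second because \<open>2 N\<close> is not
  divisible by \<open>4 N\<close>.
\<close>

section \<open>Generation and commutation in groups\<close>

context group
begin

lemma inv_m_cancel:
  "x \<in> carrier G \<Longrightarrow> y \<in> carrier G \<Longrightarrow> inv x \<otimes> (x \<otimes> y) = y"
  "x \<in> carrier G \<Longrightarrow> y \<in> carrier G \<Longrightarrow> x \<otimes> (inv x \<otimes> y) = y"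
  by (simp_all add: m_assoc[symmetric])

lemma int_pow_commute:
  assumes eq: "x \<otimes> y = y \<otimes> x" and xy: "x \<in> carrier G" "y \<in> carrier G"
  shows "x [^] (k::int) \<otimes> y = y \<otimes> x [^] k"
proof (cases k rule: int_cases2)
  case (nonneg n)
  then show ?thesis using group_commutes_pow[OF assms] by (simp add: int_pow_int)
next
  case (nonpos n)
  have "inv x \<otimes> y = inv x \<otimes> (y \<otimes> x) \<otimes> inv x" using xy by (simp add: m_assoc)
  also have "\<dots> = y \<otimes> inv x" using xy by (simp add: eq[symmetric] m_assoc inv_m_cancel)
  finally have "inv x \<otimes> y = y \<otimes> inv x" .
  from group_commutes_pow[OF this, of n] xy show ?thesis
    by (simp add: nonpos int_pow_neg_int nat_pow_inv)
qed

lemma int_pow_conjugate: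
  assumes "g \<in> carrier G" "x \<in> carrier G"
  shows "(inv g \<otimes> x \<otimes> g) [^] (k::int) = inv g \<otimes> x [^] k \<otimes> g"
proof -
  have "(\<lambda>x. inv g \<otimes> x \<otimes> g) \<in> hom G G"
    using assms(1) by (intro homI) (simp_all add: m_assoc inv_m_cancel)
  from hom_int_pow[OF this assms(2) is_group is_group, where n = k] show ?thesis by simp
qed

lemma inv_eq_nat_pow:
  assumes "a \<in> carrier G" "ord a \<noteq> 0"
  obtains n :: nat where "inv a = a [^] n"
proof -
  obtain n where n: "ord a = Suc n" using assms(2) not0_implies_Suc by blast
  have "a [^] n \<otimes> a = \<one>" using pow_ord_eq_1[OF assms(1)] by (simp add: n)
  then have "inv a = a [^] n" by (rule inv_equality) (simp_all add: assms(1))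
  then show thesis by (rule that)
qed

text \<open>Inverses need no separate induction step because the generators have finite order.\<close>

lemma generate_induct_left [consumes 3, case_names one mult]:
  assumes A: "A \<subseteq> carrier G" "\<And>a. a \<in> A \<Longrightarrow> ord a \<noteq> 0" and x: "x \<in> generate G A"
    and one: "P \<one>" and mult: "\<And>a x. a \<in> A \<Longrightarrow> x \<in> generate G A \<Longrightarrow> P x \<Longrightarrow> P (a \<otimes> x)"
  shows "P x"
proof -
  have closed: "y \<in> carrier G" if "y \<in> generate G A" for y
    using A(1) that by (rule generate_in_carrier)
  have pow: "a [^] n \<otimes> y \<in> generate G A \<and> P (a [^] n \<otimes> y)"
    if "a \<in> A" "y \<in> generate G A" "P y" for a y and n :: nat
  proof (induction n)
    case (Suc n)
    have a: "a \<in> carrier G" "a \<in> generate G A" using \<open>a \<in> A\<close> A(1) by (auto intro: generate.incl)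
    then have "a [^] Suc n \<otimes> y = a \<otimes> (a [^] n \<otimes> y)"
      using closed[OF that(2)] by (simp only: nat_pow_Suc2 m_assoc nat_pow_closed)
    then show ?case using Suc.IH mult[OF \<open>a \<in> A\<close>] generate.eng[OF a(2)] by metis
  qed (simp add: that closed)
  have "\<forall>y\<in>generate G A. P y \<longrightarrow> P (x \<otimes> y)"
    using x
  proof (induction rule: generate.induct)
    case one
    show ?case using closed by simp
  next
    case (incl a)
    then show ?case using mult by blast
  next
    case (inv a)
    then have "a \<in> carrier G" "ord a \<noteq> 0" using A by auto
    then obtain n :: nat where "inv a = a [^] n" by (rule inv_eq_nat_pow)
    then show ?case using pow[OF \<open>a \<in> A\<close>] by simp
  next
    case (eng x1 x2)
    then have "P (x1 \<otimes> (x2 \<otimes> y))" if "y \<in> generate G A" "P y" for y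
      using that by (simp add: generate.eng)
    then show ?case using eng.hyps closed by (simp add: m_assoc)
  qed
  then have "P (x \<otimes> \<one>)" using one generate.one by blast
  then show ?thesis using closed[OF x] by simp
qed

lemma card_set_mult_of_trivial_inter:
  assumes "subgroup H G" "subgroup K G" "H \<inter> K = {\<one>}"
  shows "card (H <#> K) = card H * card K"
proof -
  interpret group_disjoint_sum G H K
    using assms by (intro group_disjoint_sum.intro is_group)
  have "inj_on (\<lambda>(x, y). x \<otimes> y) (H \<times> K)"
    using cancel assms(3) by (auto simp: inj_on_def)
  moreover have "H <#> K = (\<lambda>(x, y). x \<otimes> y) ` (H \<times> K)" by (auto simp: set_mult_def)
  ultimately show ?thesis by (simp add: card_image card_cartesian_product)
qed

end

lemma DirProd_int_pow:
  assumes "group G" "group H" "a \<in> carrier G" "b \<in> carrier H"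
  shows "(a, b) [^]\<^bsub>G \<times>\<times> H\<^esub> (k::int) = (a [^]\<^bsub>G\<^esub> k, b [^]\<^bsub>H\<^esub> k)"
proof (rule prod_eqI)
  have GH: "group (G \<times>\<times> H)" using assms(1,2) by (rule DirProd_group)
  have fst: "fst \<in> hom (G \<times>\<times> H) G" and snd: "snd \<in> hom (G \<times>\<times> H) H"
    by (auto intro!: homI simp: mult_DirProd')
  show "fst ((a, b) [^]\<^bsub>G \<times>\<times> H\<^esub> k) = fst (a [^]\<^bsub>G\<^esub> k, b [^]\<^bsub>H\<^esub> k)"
    using hom_int_pow[OF fst _ GH assms(1), of "(a, b)" k] assms(3,4) by simp
  show "snd ((a, b) [^]\<^bsub>G \<times>\<times> H\<^esub> k) = snd (a [^]\<^bsub>G\<^esub> k, b [^]\<^bsub>H\<^esub> k)"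
    using hom_int_pow[OF snd _ GH assms(2), of "(a, b)" k] assms(3,4) by simp
qed

section \<open>Homomorphisms from presented groups\<close>

primrec word_eval :: "('a, 'b) monoid_scheme \<Rightarrow> ('g \<Rightarrow> 'a) \<Rightarrow> 'g word \<Rightarrow> 'a" where
  "word_eval G f [] = \<one>\<^bsub>G\<^esub>"
| "word_eval G f (l # w) =
     (if snd l then f (fst l) else inv\<^bsub>G\<^esub> f (fst l)) \<otimes>\<^bsub>G\<^esub> word_eval G f w"

context group
begin

context
  fixes f :: "'g \<Rightarrow> 'a"
  assumes f_closed [simp]: "\<And>x. f x \<in> carrier G"
begin

lemma word_eval_closed [simp]: "word_eval G f w \<in> carrier G"
  by (induction w) auto

lemma word_eval_append: "word_eval G f (u @ v) = word_eval G f u \<otimes> word_eval G f v"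
  by (induction u) (simp_all add: m_assoc)

lemma word_eval_replicate:
  "word_eval G f (replicate n (x, b)) = (if b then f x else inv f x) [^] n"
proof (induction n)
  case (Suc n)
  have "word_eval G f (replicate (Suc n) (x, b))
    = (if b then f x else inv f x) \<otimes> (if b then f x else inv f x) [^] n"
    using Suc by simp
  also have "\<dots> = (if b then f x else inv f x) [^] Suc n"
    by (rule nat_pow_Suc2[symmetric]) simp
  finally show ?case .
qed simp

lemma word_eval_gen_pow: "word_eval G f (gen_pow x k) = f x [^] k"
  by (cases "0 \<le> k")
    (simp_all add: gen_pow_def word_eval_replicate pow_nat int_pow_inv int_pow_neg)

lemma word_eq_imp_word_eval_eq:
  assumes rels: "\<And>l r. (l, r) \<in> R \<Longrightarrow> word_eval G f l = word_eval G f r"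
    and "word_eq R u v"
  shows "word_eval G f u = word_eval G f v"
  using \<open>word_eq R u v\<close>
proof (induction rule: word_eq.induct)
  case (cancel u x b v)
  then show ?case by (cases b) (simp_all add: word_eval_append m_assoc[symmetric])
qed (simp_all add: word_eval_append rels)

lemma presented_group_lift:
  assumes rels: "\<And>l r. (l, r) \<in> R \<Longrightarrow> word_eval G f l = word_eval G f r"
  shows "\<exists>h\<in>hom (presented_group R) G. \<forall>w. h (word_class R w) = word_eval G f w"
proof
  define h where "h A = word_eval G f (SOME w. w \<in> A)" for A
  have h: "h (word_class R w) = word_eval G f w" for w
  proof -
    have "word_eq R w (SOME v. v \<in> word_class R w)"
      by (rule someI2[of _ w]) (simp_all add: word_class_def word_eq.refl)
    from word_eq_imp_word_eval_eq[OF rels this] show ?thesis by (simp add: h_def)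
  qed
  then show "\<forall>w. h (word_class R w) = word_eval G f w" by blast
  show "h \<in> hom (presented_group R) G"
  proof (rule homI)
    fix A B assume "A \<in> carrier (presented_group R)" "B \<in> carrier (presented_group R)"
    then obtain u v where "A = word_class R u" "B = word_class R v"
      by (auto simp: presented_group_def)
    then show "h (A \<otimes>\<^bsub>presented_group R\<^esub> B) = h A \<otimes> h B"
      by (simp add: presented_group_mult h word_eval_append)
  qed (auto simp: presented_group_def h)
qed

end

end

lemma word_class_closed: "word_class R w \<in> carrier (presented_group R)"
  by (simp add: presented_group_def)

lemma presented_group_inv_letter:
  "inv\<^bsub>presented_group R\<^esub> word_class R [(x, True)] = word_class R [(x, False)]"
proof (rule group.inv_equality[OF group_presented_group _ word_class_closed word_class_closed])
  show "word_class R [(x, False)] \<otimes>\<^bsub>presented_group R\<^esub> word_class R [(x, True)]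
    = \<one>\<^bsub>presented_group R\<^esub>"
    using word_eq.cancel[of R "[]" x False "[]"]
    by (simp add: presented_group_mult word_class_eq_iff)
      (simp add: presented_group_def word_class_eq_iff)
qed

lemma word_eval_presented_group:
  "word_eval (presented_group R) (\<lambda>x. word_class R [(x, True)]) w = word_class R w"
proof (induction w)
  case Nil
  show ?case by (simp add: presented_group_def)
next
  case (Cons l w)
  then show ?case by (cases l) (simp add: presented_group_inv_letter presented_group_mult)
qed

lemma word_class_rel: "(l, r) \<in> R \<Longrightarrow> word_class R l = word_class R r"
  using word_eq.rel[of l r R "[]" "[]"] by (simp add: word_class_eq_iff)

locale Gamma_relations = group G for G :: "('a, 'b) monoid_scheme" (structure) +
  fixes s t :: 'a and p q i1 j1 i2 j2 :: int
  assumes s_closed [simp]: "s \<in> carrier G" and t_closed [simp]: "t \<in> carrier G"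
    and s_pow: "s [^] p = \<one>" and t_pow: "t [^] q = \<one>"
    and st_involution: "s \<otimes> t \<otimes> (s \<otimes> t) = \<one>"
    and inv_t_mult_s: "inv t \<otimes> s = s [^] i1 \<otimes> t [^] j1"
    and t_mult_inv_s: "t \<otimes> inv s = s [^] i2 \<otimes> t [^] j2"

lemma (in group) Gamma_relations_iff_word_eval:
  assumes [simp]: "\<And>x. f x \<in> carrier G"
  shows "Gamma_relations G (f Sigma1) (f Sigma2) p q i1 j1 i2 j2 \<longleftrightarrow>
    (\<forall>(l, r)\<in>Gamma_rels p q i1 j1 i2 j2. word_eval G f l = word_eval G f r)"
  using group_axioms
  by (simp add: Gamma_relations_def Gamma_relations_axioms_def Gamma_rels_def
      word_eval_append word_eval_gen_pow m_assoc)

lemma (in Gamma_relations) Gamma_relations_cong: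
  assumes "p dvd p'" "q dvd q'" "[i1 = i1'] (mod p)" "[j1 = j1'] (mod q)"
    "[i2 = i2'] (mod p)" "[j2 = j2'] (mod q)"
  shows "Gamma_relations G s t p' q' i1' j1' i2' j2'"
proof -
  have ord: "int (ord s) dvd p" "int (ord t) dvd q"
    using s_pow t_pow by (simp_all add: int_pow_eq_id)
  have "s [^] i = s [^] i'" if "[i = i'] (mod p)" for i i'
    using that ord(1) by (metis cong_dvd_modulus cong_iff_dvd_diff cong_sym int_pow_eq s_closed)
  moreover have "t [^] j = t [^] j'" if "[j = j'] (mod q)" for j j'
    using that ord(2) by (metis cong_dvd_modulus cong_iff_dvd_diff cong_sym int_pow_eq t_closed)
  moreover have "s [^] p' = \<one>" "t [^] q' = \<one>"
    using ord assms(1,2) by (auto simp: int_pow_eq_id)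
  ultimately show ?thesis
    using assms(3-6) inv_t_mult_s t_mult_inv_s st_involution by unfold_locales auto
qed

lemma Gamma_relations_Gamma:
  assumes "Gamma p q i1 j1 i2 j2 = (H, a, b)"
  shows "Gamma_relations H a b p q i1 j1 i2 j2"
proof -
  define R where "R = Gamma_rels p q i1 j1 i2 j2"
  have H: "H = presented_group R" "a = word_class R [(Sigma1, True)]"
    "b = word_class R [(Sigma2, True)]"
    using assms by (simp_all add: Gamma_def Let_def R_def)
  have "\<forall>(l, r)\<in>R. word_class R l = word_class R r"
    using word_class_rel by blast
  then show ?thesis
    unfolding H R_def
    by (subst group.Gamma_relations_iff_word_eval[OF group_presented_group word_class_closed])
      (simp only: word_eval_presented_group)
qed

lemma (in Gamma_relations) Gamma_hom:
  assumes "Gamma p q i1 j1 i2 j2 = (H, a, b)"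
  shows "\<exists>h\<in>hom H G. h a = s \<and> h b = t"
proof -
  define f where "f = (\<lambda>x. case x of Sigma1 \<Rightarrow> s | Sigma2 \<Rightarrow> t)"
  have f: "f x \<in> carrier G" "f Sigma1 = s" "f Sigma2 = t" for x by (cases x; simp add: f_def)+
  have "\<forall>(l, r)\<in>Gamma_rels p q i1 j1 i2 j2. word_eval G f l = word_eval G f r"
    using Gamma_relations_iff_word_eval[of f] Gamma_relations_axioms f by simp
  then obtain h where h: "h \<in> hom (presented_group (Gamma_rels p q i1 j1 i2 j2)) G"
    and h_word: "\<And>w. h (word_class (Gamma_rels p q i1 j1 i2 j2) w) = word_eval G f w"
    using presented_group_lift[of f "Gamma_rels p q i1 j1 i2 j2"] f(1) by fast
  have H: "H = presented_group (Gamma_rels p q i1 j1 i2 j2)"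
    "a = word_class (Gamma_rels p q i1 j1 i2 j2) [(Sigma1, True)]"
    "b = word_class (Gamma_rels p q i1 j1 i2 j2) [(Sigma2, True)]"
    using assms by (simp_all add: Gamma_def Let_def)
  show ?thesis
    unfolding H by (rule bexI[OF _ h]) (simp add: h_word f)
qed

section \<open>Permutations of residues\<close>

locale int_action_mod =
  fixes m :: int and P :: "int \<Rightarrow> int \<Rightarrow> int"
  assumes modulus_pos: "m > 0"
    and action_cong: "[x = y] (mod m) \<Longrightarrow> [P k x = P k y] (mod m)"
    and action_zero: "[P 0 x = x] (mod m)"
    and action_add: "[P a (P b x) = P (a + b) x] (mod m)"
begin

abbreviation perm_group :: "(int \<Rightarrow> int) monoid" where
  "perm_group \<equiv> BijGroup {0..<m}"

definition perm :: "int \<Rightarrow> int \<Rightarrow> int" where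
  "perm k = (\<lambda>x\<in>{0..<m}. P k x mod m)"

lemma mod_mem: "y mod m \<in> {0..<m}"
  using modulus_pos by simp

lemma perm_mod: "perm k (y mod m) = P k y mod m"
  using mod_mem action_cong[of "y mod m" y k] by (simp add: perm_def cong_def)

lemma perm_perm_mod: "perm a (perm b (y mod m)) = perm (a + b) (y mod m)"
  using action_add[of a b y] by (simp add: perm_mod cong_def)

lemma perm_zero_mod: "perm 0 (y mod m) = y mod m"
  using action_zero[of y] by (simp add: perm_mod cong_def)

lemma perm_closed: "perm k \<in> carrier perm_group"
proof -
  have "perm k x \<in> {0..<m}" "perm (- k) (perm k x) = x" "perm k (perm (- k) x) = x"
    if "x \<in> {0..<m}" for k x
    using that mod_mem perm_perm_mod[of _ _ x] perm_zero_mod[of x] perm_mod[of _ x] by simp_all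
  then have "bij_betw (perm k) {0..<m} {0..<m}"
    by (intro bij_betw_byWitness[of _ "perm (- k)"]) auto
  then show ?thesis by (simp add: BijGroup_def Bij_def perm_def)
qed

lemma perm_group_eqI:
  assumes "g \<in> carrier perm_group" "h \<in> carrier perm_group"
    and "\<And>y. g (y mod m) = h (y mod m)"
  shows "g = h"
proof (rule extensionalityI[of _ "{0..<m}"])
  show "g \<in> extensional {0..<m}" "h \<in> extensional {0..<m}"
    using assms(1,2) by (simp_all add: BijGroup_def Bij_imp_extensional)
  show "g x = h x" if "x \<in> {0..<m}" for x
    using assms(3)[of x] that by simp
qed

lemma perm_group_mult_mod:
  assumes "g \<in> carrier perm_group" "h \<in> carrier perm_group"
  shows "(g \<otimes>\<^bsub>perm_group\<^esub> h) (y mod m) = g (h (y mod m))"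
  using assms mod_mem by (simp add: BijGroup_def compose_eq del: atLeastLessThan_iff)

lemma perm_group_one_mod: "\<one>\<^bsub>perm_group\<^esub> (y mod m) = y mod m"
  using mod_mem by (simp add: BijGroup_def)

lemma perm_hom: "perm \<in> hom integer_group perm_group"
proof (rule homI)
  interpret group perm_group by (rule group_BijGroup)
  fix a b
  show "perm (a \<otimes>\<^bsub>integer_group\<^esub> b) = perm a \<otimes>\<^bsub>perm_group\<^esub> perm b"
    by (rule perm_group_eqI) (simp_all add: perm_closed perm_group_mult_mod perm_perm_mod)
qed (rule perm_closed)

lemma perm_pow: "perm 1 [^]\<^bsub>perm_group\<^esub> k = perm k" for k :: int
  using hom_int_pow[OF perm_hom, of 1 k] by (simp add: group_BijGroup)

lemma perm_inv: "inv\<^bsub>perm_group\<^esub> perm 1 = perm (- 1)"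
proof -
  interpret group perm_group by (rule group_BijGroup)
  show ?thesis
    using int_pow_neg[OF perm_closed, of 1 1] int_pow_1[OF perm_closed, of 1]
      perm_pow[of "- 1"]
    by simp
qed

end

locale Gamma_model = P: int_action_mod m P + Q: int_action_mod m Q
  for m P Q +
  fixes p q i1 j1 i2 j2 :: int
  assumes P_p: "[P p x = x] (mod m)" and Q_q: "[Q q x = x] (mod m)"
    and PQ_involution: "[P 1 (Q 1 (P 1 (Q 1 x))) = x] (mod m)"
    and Q_inv_P: "[Q (-1) (P 1 x) = P i1 (Q j1 x)] (mod m)"
    and Q_P_inv: "[Q 1 (P (-1) x) = P i2 (Q j2 x)] (mod m)"
begin

sublocale perm: Gamma_relations P.perm_group "P.perm 1" "Q.perm 1" p q i1 j1 i2 j2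
proof -
  interpret group P.perm_group by (rule group_BijGroup)
  note closed = P.perm_closed Q.perm_closed
  note simps = P.perm_pow Q.perm_pow P.perm_inv Q.perm_inv closed P.perm_mod Q.perm_mod
    P.perm_group_mult_mod P.perm_group_one_mod
  note congs = P_p Q_q PQ_involution Q_inv_P Q_P_inv
  show "Gamma_relations P.perm_group (P.perm 1) (Q.perm 1) p q i1 j1 i2 j2"
    by unfold_locales
      (rule closed, rule closed,
        (rule P.perm_group_eqI; use congs in \<open>simp add: simps cong_def\<close>)+)
qed

lemma Gamma_powers_eq_imp_cong:
  assumes Gamma: "Gamma p q i1 j1 i2 j2 = (H, a, b)" and eq: "a [^]\<^bsub>H\<^esub> i = b [^]\<^bsub>H\<^esub> j"
  shows "[P i x = Q j x] (mod m)"
proof -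
  interpret H: Gamma_relations H a b p q i1 j1 i2 j2 by (rule Gamma_relations_Gamma[OF Gamma])
  obtain h where "h \<in> hom H P.perm_group" and h_gens: "h a = P.perm 1" "h b = Q.perm 1"
    using perm.Gamma_hom[OF Gamma] by blast
  then interpret h: group_hom H P.perm_group h
    by (intro group_hom.intro group_hom_axioms.intro) unfold_locales
  have "P.perm i = Q.perm j"
    using arg_cong[OF eq, of h] by (simp add: h.hom_int_pow h_gens P.perm_pow Q.perm_pow)
  then show ?thesis
    using P.perm_mod[of i x] Q.perm_mod[of j x] by (simp add: cong_def)
qed

end

section \<open>The actions of the two factors on cosets\<close>

lemma cong_diff_multI: "u - v = m * k \<Longrightarrow> [u = v] (mod m)" for u v m k :: int
  by (simp add: cong_iff_dvd_diff)

lemma int_action_mod_translation: "m > 0 \<Longrightarrow> int_action_mod m (\<lambda>n x. x + n)"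
  by unfold_locales (simp_all add: cong_add ac_simps)

text \<open>The action of \<open>\<sigma>\<^sub>1\<^sup>n\<close> on the cosets \<open>\<sigma>\<^sub>2\<^sup>y \<langle>\<sigma>\<^sub>1\<rangle>\<close> in \<open>\<Gamma>\<^sub>1\<close>, where \<open>2\<^sup>\<alpha> = 32 M\<close>.\<close>

definition face_action :: "int \<Rightarrow> int \<Rightarrow> int \<Rightarrow> int" where
  "face_action M n y = (if even y then y - 4 * n * M * y else y - 2 * n + 4 * M * n * (y - n))"

lemma face_action_0: "face_action M n 0 = 0"
  by (simp add: face_action_def)

lemma face_action_cong:
  assumes "[x = y] (mod 32 * M)"
  shows "[face_action M n x = face_action M n y] (mod 32 * M)"
proof -
  obtain l where x: "x = y + 32 * M * l"
    using cong_sym[OF assms] by (auto simp: cong_iff_lin)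
  show ?thesis
    by (rule cong_diff_multI[where
          k = "if even y then l * (1 - 4 * n * M) else l * (1 + 4 * M * n)"])
      (simp add: face_action_def x algebra_simps)
qed

lemma face_action_add:
  "[face_action M a (face_action M b y) = face_action M (a + b) y] (mod 32 * M)"
proof -
  consider z where "y = 2 * z" | z c where "y = 2 * z + 1" "b = 2 * c"
    | z c where "y = 2 * z + 1" "b = 2 * c + 1"
    by (metis evenE oddE)
  then show ?thesis
  proof cases
    case (1 z)
    then show ?thesis
      by (intro cong_diff_multI[where k = "a * b * M * z"])
        (simp add: face_action_def algebra_simps)
  next
    case (2 z c)
    then show ?thesis
      by (intro cong_diff_multI[where k = "M * a * c * (y - b)"])
        (simp add: face_action_def algebra_simps)
  next
    case (3 z c)
    then show ?thesis
      by (intro cong_diff_multI[where k = "M * a * b * (z - c)"])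
        (simp add: face_action_def algebra_simps)
  qed
qed

lemma int_action_mod_face_action: "M > 0 \<Longrightarrow> int_action_mod (32 * M) (face_action M)"
  by unfold_locales (simp_all add: face_action_cong face_action_add, simp add: face_action_def)

lemma Gamma_model_face_action:
  assumes "M > 0"
  shows "Gamma_model (32 * M) (face_action M) (\<lambda>n y. y + n)
    (16 * M) (32 * M) (-1 + 8 * M) (-3 + 8 * M) (1 + 8 * M) (3 + 8 * M)"
proof (intro Gamma_model.intro Gamma_model_axioms.intro)
  show "int_action_mod (32 * M) (face_action M)" "int_action_mod (32 * M) (\<lambda>n y. y + n)"
    using assms by (simp_all add: int_action_mod_face_action int_action_mod_translation)
  fix y :: int
  show "[face_action M (16 * M) y = y] (mod 32 * M)"
    by (rule cong_diff_multI[where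
          k = "if even y then - 2 * M * y else - 1 + 2 * M * (y - 16 * M)"])
      (simp add: face_action_def algebra_simps)
  show "[face_action M 1 (face_action M 1 (y + 1) + 1) = y] (mod 32 * M)"
  proof (cases "even y")
    case True
    then obtain z where "y = 2 * z" by blast
    then show ?thesis
      by (intro cong_diff_multI[where k = "- M * z"]) (simp add: face_action_def algebra_simps)
  next
    case False
    then obtain z where "y = 2 * z + 1" by (elim oddE)
    then show ?thesis
      by (intro cong_diff_multI[where k = "- M * (z + 1)"])
        (simp add: face_action_def algebra_simps)
  qed
  show "[face_action M 1 y + - 1 = face_action M (- 1 + 8 * M) (y + (- 3 + 8 * M))] (mod 32 * M)"
    by (rule cong_diff_multI[where k = "if even y then - M * (y - 2) else M * (y - 4 + 8 * M)"])
      (simp add: face_action_def algebra_simps)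
  show "[face_action M (- 1) y + 1 = face_action M (1 + 8 * M) (y + (3 + 8 * M))] (mod 32 * M)"
    by (rule cong_diff_multI[where k = "if even y then - M * (y + 2) else M * (y + 4 + 8 * M)"])
      (simp add: face_action_def algebra_simps)
  show "[y + 32 * M = y] (mod 32 * M)" by (simp add: cong_def)
qed

text \<open>The action of \<open>\<sigma>\<^sub>2\<^sup>n\<close> on the cosets \<open>\<sigma>\<^sub>1\<^sup>x \<langle>\<sigma>\<^sub>2\<rangle>\<close> in \<open>\<Gamma>\<^sub>2\<close>.\<close>

definition vertex_action :: "int \<Rightarrow> int \<Rightarrow> int \<Rightarrow> int" where
  "vertex_action M n x = (if even n then x + 4 * n * M * x else - x + 4 * M * x * (x - n))"

lemma vertex_action_0: "vertex_action M n 0 = 0"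
  by (simp add: vertex_action_def)

lemma vertex_action_odd:
  assumes "odd n"
  obtains v where "x * (x - n) = 2 * v" "vertex_action M n x = - x + 8 * M * v"
proof -
  have "even (x * (x - n))" using assms by simp
  then obtain v where v: "x * (x - n) = 2 * v" by blast
  moreover have "vertex_action M n x = - x + 8 * M * v"
    using assms v by (simp add: vertex_action_def mult.assoc)
  ultimately show thesis by (rule that)
qed

lemma vertex_action_cong:
  assumes "[x = y] (mod 32 * M)"
  shows "[vertex_action M n x = vertex_action M n y] (mod 32 * M)"
proof -
  obtain l where x: "x = y + 32 * M * l"
    using cong_sym[OF assms] by (auto simp: cong_iff_lin)
  show ?thesis
    by (rule cong_diff_multI[where k =
          "if even n then l * (1 + 4 * n * M) else - l + 4 * M * l * (x + y - n)"])
      (simp add: vertex_action_def x algebra_simps)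
qed

lemma vertex_action_add_odd:
  assumes "odd a" "odd b"
  shows "[vertex_action M a (vertex_action M b x) = vertex_action M (a + b) x] (mod 32 * M)"
proof -
  obtain v where v: "x * (x - b) = 2 * v" and inner: "vertex_action M b x = - x + 8 * M * v"
    using assms(2) by (rule vertex_action_odd)
  have "vertex_action M a (vertex_action M b x) - vertex_action M (a + b) x
    = 4 * M * (x * (x - b)) - 8 * M * v + 32 * M * (M * v * (- 2 * x - a + 8 * M * v))"
    unfolding inner using assms by (simp add: vertex_action_def algebra_simps)
  also have "\<dots> = 32 * M * (M * v * (- 2 * x - a + 8 * M * v))" by (simp add: v)
  finally show ?thesis by (rule cong_diff_multI)
qed

lemma vertex_action_add:
  "[vertex_action M a (vertex_action M b x) = vertex_action M (a + b) x] (mod 32 * M)"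
proof -
  consider c where "b = 2 * c" "even a" | c where "b = 2 * c" "odd a" | c where "a = 2 * c" "odd b"
    | "odd a" "odd b"
    by (metis evenE)
  then show ?thesis
  proof cases
    case (1 c)
    then show ?thesis
      by (intro cong_diff_multI[where k = "a * c * M * x"])
        (simp add: vertex_action_def algebra_simps)
  next
    case (2 c)
    then show ?thesis
      by (intro cong_diff_multI[where k = "c * M * x * (x + 4 * b * M * x + x - a)"])
        (simp add: vertex_action_def algebra_simps)
  next
    case (3 c)
    then show ?thesis
      by (intro cong_diff_multI[where k = "c * M * x * (x - b)"])
        (simp add: vertex_action_def algebra_simps)
  next
    case 4
    then show ?thesis by (rule vertex_action_add_odd)
  qed
qed

lemma int_action_mod_vertex_action: "M > 0 \<Longrightarrow> int_action_mod (32 * M) (vertex_action M)"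
  by unfold_locales
    (simp_all add: vertex_action_cong vertex_action_add, simp add: vertex_action_def)

lemma vertex_action_involution:
  "[vertex_action M 1 (vertex_action M 1 x + 1) + 1 = x] (mod 32 * M)"
proof -
  obtain v where v: "x * (x - 1) = 2 * v" and inner: "vertex_action M 1 x = - x + 8 * M * v"
    by (rule vertex_action_odd[of 1 x M]) simp
  have "vertex_action M 1 (vertex_action M 1 x + 1) + 1 - x
    = 4 * M * (x * (x - 1)) - 8 * M * v + 32 * M * (M * v * (1 - 2 * x + 8 * M * v))"
    unfolding inner by (simp add: vertex_action_def algebra_simps)
  also have "\<dots> = 32 * M * (M * v * (1 - 2 * x + 8 * M * v))" by (simp add: v)
  finally show ?thesis by (rule cong_diff_multI)
qed

lemma Gamma_model_vertex_action:
  assumes "M > 0"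
  shows "Gamma_model (32 * M) (\<lambda>n x. x + n) (vertex_action M)
    (32 * M) 8 (-1 + 8 * M) (-3) (1 + 8 * M) 3"
proof (intro Gamma_model.intro Gamma_model_axioms.intro)
  show "int_action_mod (32 * M) (vertex_action M)" "int_action_mod (32 * M) (\<lambda>n x. x + n)"
    using assms by (simp_all add: int_action_mod_vertex_action int_action_mod_translation)
  fix x :: int
  show "[vertex_action M 8 x = x] (mod 32 * M)"
    by (rule cong_diff_multI[where k = x]) (simp add: vertex_action_def)
  show "[vertex_action M 1 (vertex_action M 1 x + 1) + 1 = x] (mod 32 * M)"
    by (rule vertex_action_involution)
  show "[vertex_action M (- 1) (x + 1) = vertex_action M (- 3) x + (- 1 + 8 * M)] (mod 32 * M)"
    by (rule cong_diff_multI[where k = 0]) (simp add: vertex_action_def algebra_simps)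
  show "[vertex_action M 1 (x + - 1) = vertex_action M 3 x + (1 + 8 * M)] (mod 32 * M)"
    by (rule cong_diff_multI[where k = 0]) (simp add: vertex_action_def algebra_simps)
  show "[x + 32 * M = x] (mod 32 * M)" by (simp add: cong_def)
qed

section \<open>Factorisation into powers of the two generators\<close>

locale twisted_Gamma_relations =
  Gamma_relations G s t p q "-1 + N" "-3 + N" "1 + N" "3 + N"
  for G :: "('a, 'b) monoid_scheme" (structure) and s t p q N +
  assumes N_even: "even N" and p_nonzero: "p \<noteq> 0" and coprime_3_q: "coprime 3 q"
begin

lemma s_mult_t: "s \<otimes> t = inv t \<otimes> inv s"
  using inv_equality[OF st_involution] by (simp add: inv_mult_group)

lemma t_mult_s: "t \<otimes> s = inv s \<otimes> inv t"
proof -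
  have "t \<otimes> s = t \<otimes> (s \<otimes> t) \<otimes> inv t" by (simp add: m_assoc)
  also have "\<dots> = inv s \<otimes> inv t" by (simp add: s_mult_t m_assoc[symmetric])
  finally show ?thesis .
qed

lemma t_2_conjugate_s: "inv s \<otimes> t [^] (2::int) \<otimes> s = s [^] N \<otimes> t [^] (2 + N)"
proof -
  have "inv s \<otimes> t [^] (2::int) \<otimes> s = inv s \<otimes> (t \<otimes> (t \<otimes> s))"
    using int_pow_mult[of t 1 1] by (simp add: m_assoc)
  also have "\<dots> = inv s \<otimes> (s [^] (1 + N) \<otimes> t [^] (3 + N) \<otimes> inv t)"
    by (simp add: t_mult_s t_mult_inv_s m_assoc[symmetric])
  also have "\<dots> = s [^] N \<otimes> t [^] (2 + N)"
    using int_pow_mult[of s "-1" "1 + N"] int_pow_mult[of t "3 + N" "-1"]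
    by (simp add: int_pow_neg m_assoc)
  finally show ?thesis .
qed

lemma t_2_conjugate_inv_s: "s \<otimes> t [^] (2::int) \<otimes> inv s = t [^] (2 - N) \<otimes> s [^] (- N)"
proof -
  have "s \<otimes> t [^] (-2::int) \<otimes> inv s = s \<otimes> (inv t \<otimes> (inv t \<otimes> inv s))"
    using int_pow_mult[of t "-1" "-1"] by (simp add: int_pow_neg m_assoc)
  also have "\<dots> = s \<otimes> (s [^] (- 1 + N) \<otimes> t [^] (- 3 + N) \<otimes> t)"
    by (simp add: s_mult_t[symmetric] inv_t_mult_s m_assoc[symmetric])
  also have "\<dots> = s [^] N \<otimes> t [^] (-2 + N)"
    using int_pow_mult[of s 1 "-1 + N"] int_pow_mult[of t "- 3 + N" 1]
    by (simp add: m_assoc)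
  finally have "inv (s \<otimes> t [^] (-2::int) \<otimes> inv s) = inv (s [^] N \<otimes> t [^] (-2 + N))" by simp
  then show ?thesis
    by (simp add: inv_mult_group m_assoc int_pow_neg[symmetric])
qed

lemma s_N_mult_t: "s [^] N \<otimes> t [^] (3 + N) = t [^] (3 - N) \<otimes> s [^] (- N)"
proof -
  have "s [^] N \<otimes> t [^] (2 + N) = inv s \<otimes> inv t \<otimes> t [^] (3::int) \<otimes> s"
    using int_pow_mult[of t "-1" 3] by (simp add: t_2_conjugate_s[symmetric] int_pow_neg m_assoc)
  also have "\<dots> = t \<otimes> s \<otimes> t [^] (2::int) \<otimes> (t \<otimes> s)"
    using int_pow_mult[of t 2 1] by (simp add: t_mult_s m_assoc)
  also have "\<dots> = t \<otimes> (s \<otimes> t [^] (2::int) \<otimes> inv s) \<otimes> inv t"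
    by (simp add: t_mult_s m_assoc) (simp add: t_mult_s m_assoc[symmetric])
  also have "\<dots> = t [^] (3 - N) \<otimes> s [^] (- N) \<otimes> inv t"
    using int_pow_mult[of t 1 "2 - N"] by (simp add: t_2_conjugate_inv_s m_assoc)
  finally show ?thesis
    using int_pow_mult[of t "2 + N" 1] by (simp add: m_assoc[symmetric]) (simp add: m_assoc)
qed

lemma t_6_commutes_s_N: "t [^] (6::int) \<otimes> s [^] N = s [^] N \<otimes> t [^] (6::int)"
proof -
  have "inv (s [^] N \<otimes> t [^] (3 + N)) = inv (t [^] (3 - N) \<otimes> s [^] (- N))"
    by (simp only: s_N_mult_t)
  then have inverted: "t [^] (- 3 - N) \<otimes> s [^] (- N) = s [^] N \<otimes> t [^] (- 3 + N)"
    by (simp add: inv_mult_group int_pow_neg[symmetric])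
  have "s [^] N \<otimes> t [^] (6::int) = s [^] N \<otimes> t [^] (3 + N) \<otimes> t [^] (3 - N)"
    by (simp add: m_assoc int_pow_mult[symmetric])
  also have "\<dots> = t [^] (6::int) \<otimes> (t [^] (- 3 - N) \<otimes> s [^] (- N)) \<otimes> t [^] (3 - N)"
    by (simp add: s_N_mult_t m_assoc[symmetric] int_pow_mult[symmetric])
  also have "\<dots> = t [^] (6::int) \<otimes> s [^] N"
    by (simp add: inverted m_assoc int_pow_mult[symmetric])
  finally show ?thesis by simp
qed

text \<open>Since 3 is invertible modulo \<open>q\<close>, the even powers of \<open>t\<close> are powers of \<open>t\<^sup>6\<close>.\<close>

lemma t_even_commutes_s_N:
  fixes j :: int
  assumes "even j"
  shows "t [^] j \<otimes> s [^] N = s [^] N \<otimes> t [^] j"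
proof -
  obtain c where c: "j = 2 * c" using assms by blast
  obtain a b :: int where ab: "a * 3 + b * q = 1"
    using coprime_3_q by (metis bezout_int coprime_imp_gcd_eq_1)
  have "j = 6 * (c * a) + q * (b * j)"
    using arg_cong[OF ab, of "\<lambda>z. j * z"] c by (simp add: algebra_simps)
  then have "t [^] j = t [^] (6 * (c * a)) \<otimes> t [^] (q * (b * j))"
    by (metis int_pow_mult t_closed)
  then have "t [^] j = (t [^] (6::int)) [^] (c * a)"
    by (simp add: int_pow_pow[symmetric] t_pow)
  then show ?thesis using int_pow_commute[OF t_6_commutes_s_N] by simp
qed

lemma t_even_mult_s: "t [^] (2 * k) \<otimes> s = s [^] (1 + N * k) \<otimes> t [^] ((2 + N) * k)"
proof -
  have "inv s \<otimes> t [^] (2 * k) \<otimes> s = (s [^] N \<otimes> t [^] (2 + N)) [^] k"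
    using int_pow_conjugate[of s "t [^] (2::int)" k] by (simp add: int_pow_pow t_2_conjugate_s)
  also have "\<dots> = s [^] (N * k) \<otimes> t [^] ((2 + N) * k)"
    using t_even_commutes_s_N[of "2 + N"] N_even by (simp add: int_pow_mult_distrib int_pow_pow)
  finally have "inv s \<otimes> (t [^] (2 * k) \<otimes> s) = s [^] (N * k) \<otimes> t [^] ((2 + N) * k)"
    by (simp add: m_assoc)
  then have "t [^] (2 * k) \<otimes> s = s \<otimes> (s [^] (N * k) \<otimes> t [^] ((2 + N) * k))"
    by (simp add: inv_solve_left')
  then show ?thesis using int_pow_mult[of s 1 "N * k"] by (simp add: m_assoc)
qed

lemma t_even_mult_inv_s: "t [^] (2 * k) \<otimes> inv s = s [^] (- 1 - N * k) \<otimes> t [^] ((2 - N) * k)"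
proof -
  have comm: "t [^] (2 - N) \<otimes> s [^] (- N) = s [^] (- N) \<otimes> t [^] (2 - N)"
    using int_pow_commute[OF t_even_commutes_s_N[of "2 - N", symmetric], of "- 1"] N_even
    by (simp add: int_pow_pow)
  have "s \<otimes> t [^] (2 * k) \<otimes> inv s = (t [^] (2 - N) \<otimes> s [^] (- N)) [^] k"
    using int_pow_conjugate[of "inv s" "t [^] (2::int)" k]
    by (simp add: int_pow_pow t_2_conjugate_inv_s)
  also have "\<dots> = s [^] (- N * k) \<otimes> t [^] ((2 - N) * k)"
    unfolding comm using comm by (simp add: int_pow_mult_distrib int_pow_pow)
  finally have "s \<otimes> (t [^] (2 * k) \<otimes> inv s) = s [^] (- N * k) \<otimes> t [^] ((2 - N) * k)"
    by (simp add: m_assoc)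
  then have "t [^] (2 * k) \<otimes> inv s = inv s \<otimes> (s [^] (- N * k) \<otimes> t [^] ((2 - N) * k))"
    by (simp add: inv_solve_left)
  then show ?thesis
    using int_pow_mult[of s "-1" "- N * k"] by (simp add: m_assoc int_pow_neg)
qed

lemma t_pow_mult_inv_s_factors: "\<exists>a b. t [^] (j::int) \<otimes> inv s = s [^] (a::int) \<otimes> t [^] (b::int)"
proof (cases "even j")
  case True
  then show ?thesis using t_even_mult_inv_s by blast
next
  case False
  then obtain k where k: "j + 1 = 2 * k" by (metis even_plus_one_iff evenE)
  have "inv s = t \<otimes> s \<otimes> t" by (simp add: t_mult_s m_assoc)
  then have "t [^] j \<otimes> inv s = t [^] (2 * k) \<otimes> s \<otimes> t"
    by (simp add: int_pow_mult k[symmetric] m_assoc)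
  also have "\<dots> = s [^] (1 + N * k) \<otimes> t [^] ((2 + N) * k + 1)"
    by (simp add: t_even_mult_s int_pow_mult m_assoc)
  finally show ?thesis by blast
qed

lemma ord_s_nonzero: "ord s \<noteq> 0" and ord_t_nonzero: "ord t \<noteq> 0"
proof -
  have "q \<noteq> 0" using coprime_3_q by auto
  then show "ord s \<noteq> 0" "ord t \<noteq> 0"
    using s_pow t_pow p_nonzero by (auto simp: int_pow_eq_id)
qed

lemma generate_pair_factors: "generate G {s, t} \<subseteq> generate G {s} <#> generate G {t}"
proof
  let ?factors = "\<lambda>x. \<exists>(i::int) (j::int). x = s [^] i \<otimes> t [^] j"
  fix x assume x: "x \<in> generate G {s, t}"
  then have inv_x: "inv x \<in> generate G {s, t}" by (intro generate_m_inv_closed) simp_all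
  have "?factors (inv (inv x))"
  proof (rule generate_induct_left[OF _ _ inv_x])
    have "inv \<one> = s [^] (0::int) \<otimes> t [^] (0::int)" by simp
    then show "?factors (inv \<one>)" by blast
  next
    fix a y assume a: "a \<in> {s, t}" and y: "y \<in> generate G {s, t}" and "?factors (inv y)"
    then obtain i j :: int where ij: "inv y = s [^] i \<otimes> t [^] j" by blast
    have "y \<in> carrier G" using y generate_in_carrier[of "{s, t}"] by simp
    then have inv_ay: "inv (a \<otimes> y) = s [^] i \<otimes> (t [^] j \<otimes> inv a)"
      using a by (auto simp: inv_mult_group ij m_assoc)
    consider "a = s" | "a = t" using a by blast
    then show "?factors (inv (a \<otimes> y))"
    proof cases
      case 1
      obtain k l :: int where "t [^] j \<otimes> inv s = s [^] k \<otimes> t [^] l"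
        using t_pow_mult_inv_s_factors by blast
      then have "inv (a \<otimes> y) = s [^] (i + k) \<otimes> t [^] l"
        unfolding inv_ay unfolding 1 by (simp add: int_pow_mult m_assoc)
      then show ?thesis by blast
    next
      case 2
      then have "inv (a \<otimes> y) = s [^] i \<otimes> t [^] (j - 1)"
        unfolding inv_ay by (simp add: int_pow_diff)
      then show ?thesis by blast
    qed
  qed (use ord_s_nonzero ord_t_nonzero in auto)
  moreover have "x \<in> carrier G" using x generate_in_carrier[of "{s, t}"] by simp
  ultimately show "x \<in> generate G {s} <#> generate G {t}"
    by (auto simp: set_mult_def generate_pow)
qed

end

section \<open>Flags and automorphisms of polyhedra\<close>

definition adjacent_flags :: "nat \<Rightarrow> 'a flag \<Rightarrow> 'a flag \<Rightarrow> bool" where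
  "adjacent_flags i \<Phi> \<Psi> \<longleftrightarrow> (\<forall>j\<in>{0, 1, 2}. flag_elem \<Psi> j \<noteq> flag_elem \<Phi> j \<longleftrightarrow> j = i)"

lemma adjacent_flags_sym: "adjacent_flags i \<Phi> \<Psi> \<Longrightarrow> adjacent_flags i \<Psi> \<Phi>"
  unfolding adjacent_flags_def by metis

lemma incident_commute: "incident K x y \<longleftrightarrow> incident K y x"
  by (auto simp: incident_def)

lemma card_2_ex1_other:
  assumes "card A = 2" "a \<in> A"
  shows "\<exists>!b. b \<in> A \<and> b \<noteq> a"
  using assms by (auto simp: card_2_iff)

lemma incident_less_rank:
  assumes "polyhedron K" "incident K x y" "rank K x < rank K y"
  shows "(x, y) \<in> order_rel K"
  using assms unfolding polyhedron_def incident_def by fastforce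

lemma in_flags_iff:
  assumes K: "polyhedron K"
  shows "(v, e, f) \<in> flags K \<longleftrightarrow> v \<in> of_rank K 0 \<and> e \<in> of_rank K 1 \<and> f \<in> of_rank K 2 \<and>
    incident K v e \<and> incident K e f"
proof -
  have "incident K v f"
    if "v \<in> of_rank K 0" "e \<in> of_rank K 1" "f \<in> of_rank K 2" "incident K v e" "incident K e f"
  proof -
    have "(v, e) \<in> order_rel K" "(e, f) \<in> order_rel K"
      using that by (auto intro!: incident_less_rank[OF K] simp: of_rank_def)
    moreover have "trans (order_rel K)"
      using K by (simp add: polyhedron_def partial_order_on_def preorder_on_def)
    ultimately show ?thesis by (auto simp: incident_def dest: transD)
  qed
  then show ?thesis by (auto simp: flags_def)
qed

lemma ex1_adjacent_flag:
  assumes K: "polyhedron K" and \<Phi>: "\<Phi> \<in> flags K" and i: "i \<in> {0, 1, 2}"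
  shows "\<exists>!\<Psi>. \<Psi> \<in> flags K \<and> adjacent_flags i \<Phi> \<Psi>"
proof -
  obtain v e f where \<Phi>_eq: "\<Phi> = (v, e, f)" by (metis prod.exhaust)
  have vef: "v \<in> of_rank K 0" "e \<in> of_rank K 1" "f \<in> of_rank K 2"
    "incident K v e" "incident K e f" "incident K v f"
    using \<Phi> by (simp_all add: \<Phi>_eq flags_def)
  let ?V = "{a \<in> of_rank K 0. incident K a e}"
    and ?E = "{b \<in> of_rank K 1. incident K v b \<and> incident K b f}"
    and ?F = "{c \<in> of_rank K 2. incident K e c}"
  have cards: "card ?V = 2" "card ?E = 2" "card ?F = 2"
    using K vef unfolding polyhedron_def by blast+
  have unique_other: ?thesis
    if "card A = 2"
      and "\<And>\<Psi>. \<Psi> \<in> flags K \<and> adjacent_flags i \<Phi> \<Psi> \<longleftrightarrow> (\<exists>x. \<Psi> = h x \<and> x \<in> A \<and> x \<noteq> a)"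
      and "a \<in> A"
    for A a h
    using card_2_ex1_other[OF that(1,3)] that(2) by metis
  consider "i = 0" | "i = 1" | "i = 2" using i by blast
  then show ?thesis
  proof cases
    case 1
    have "\<Psi> \<in> flags K \<and> adjacent_flags i \<Phi> \<Psi> \<longleftrightarrow> (\<exists>x. \<Psi> = (x, e, f) \<and> x \<in> ?V \<and> x \<noteq> v)" for \<Psi>
      using 1 vef by (cases \<Psi>) (auto simp: in_flags_iff[OF K] adjacent_flags_def \<Phi>_eq)
    then show ?thesis by (rule unique_other[OF cards(1)]) (use vef in simp)
  next
    case 2
    have "\<Psi> \<in> flags K \<and> adjacent_flags i \<Phi> \<Psi> \<longleftrightarrow> (\<exists>x. \<Psi> = (v, x, f) \<and> x \<in> ?E \<and> x \<noteq> e)" for \<Psi>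
      using 2 vef by (cases \<Psi>) (auto simp: in_flags_iff[OF K] adjacent_flags_def \<Phi>_eq)
    then show ?thesis by (rule unique_other[OF cards(2)]) (use vef in simp)
  next
    case 3
    have "\<Psi> \<in> flags K \<and> adjacent_flags i \<Phi> \<Psi> \<longleftrightarrow> (\<exists>x. \<Psi> = (v, e, x) \<and> x \<in> ?F \<and> x \<noteq> f)" for \<Psi>
      using 3 vef by (cases \<Psi>) (auto simp: in_flags_iff[OF K] adjacent_flags_def \<Phi>_eq)
    then show ?thesis by (rule unique_other[OF cards(3)]) (use vef in simp)
  qed
qed

lemma adj_flag_eqI:
  assumes "polyhedron K" "\<Phi> \<in> flags K" "i \<in> {0, 1, 2}" "\<Psi> \<in> flags K" "adjacent_flags i \<Phi> \<Psi>"
  shows "adj_flag K i \<Phi> = \<Psi>"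
  using the1_equality[OF ex1_adjacent_flag[OF assms(1-3)]] assms(4,5)
  by (simp add: adj_flag_def adjacent_flags_def)

lemma flag_image_in_flags:
  assumes K: "polyhedron K" and g: "g \<in> carrier (aut_group K)" and \<Phi>: "\<Phi> \<in> flags K"
  shows "flag_image g \<Phi> \<in> flags K"
proof -
  obtain v e f where \<Phi>_eq: "\<Phi> = (v, e, f)" by (metis prod.exhaust)
  have vef: "v \<in> elems K" "e \<in> elems K" "f \<in> elems K" "v \<noteq> e" "e \<noteq> f"
    using \<Phi> by (auto simp: \<Phi>_eq flags_def of_rank_def)
  have bij: "bij_betw g (elems K) (elems K)"
    using g by (simp add: aut_group_def Bij_def)
  have "(v, e) \<in> order_rel K" "(e, f) \<in> order_rel K" "(v, f) \<in> order_rel K"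
    using \<Phi> by (auto simp: \<Phi>_eq flags_def of_rank_def intro!: incident_less_rank[OF K])
  then have images: "(g v, g e) \<in> order_rel K" "(g e, g f) \<in> order_rel K" "(g v, g f) \<in> order_rel K"
    using g vef by (auto simp: aut_group_def)
  have in_elems: "g v \<in> elems K" "g e \<in> elems K" "g f \<in> elems K" and "g v \<noteq> g e" "g e \<noteq> g f"
    using bij vef by (auto simp: bij_betw_def inj_on_def)
  then have "rank K (g v) < rank K (g e)" "rank K (g e) < rank K (g f)"
    "rank K (g v) \<in> {0, 1, 2}" "rank K (g e) \<in> {0, 1, 2}" "rank K (g f) \<in> {0, 1, 2}"
    using K images by (auto simp: polyhedron_def)
  then have "rank K (g v) = 0" "rank K (g e) = 1" "rank K (g f) = 2" by auto
  then show ?thesis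
    using in_elems images by (simp add: \<Phi>_eq flags_def of_rank_def incident_def)
qed

lemma flag_image_adj_flag:
  assumes K: "polyhedron K" and g: "g \<in> carrier (aut_group K)"
    and \<Phi>: "\<Phi> \<in> flags K" and i: "i \<in> {0, 1, 2}"
  shows "flag_image g (adj_flag K i \<Phi>) = adj_flag K i (flag_image g \<Phi>)"
proof -
  obtain \<Psi> where \<Psi>: "\<Psi> \<in> flags K" "adjacent_flags i \<Phi> \<Psi>"
    using ex1_adjacent_flag[OF K \<Phi> i] by blast
  have inj: "inj_on g (elems K)"
    using g by (auto simp: aut_group_def Bij_def bij_betw_def)
  have "flag_elem X j \<in> elems K" "flag_elem (flag_image g X) j = g (flag_elem X j)"
    if "X \<in> flags K" for X j
    using that by (cases X; auto simp: flags_def of_rank_def)+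
  then have "adjacent_flags i (flag_image g \<Phi>) (flag_image g \<Psi>)"
    using \<Psi> \<Phi> inj by (auto simp: adjacent_flags_def inj_on_eq_iff)
  then show ?thesis
    using adj_flag_eqI[OF K] flag_image_in_flags[OF K g] \<Phi> \<Psi> i by metis
qed

lemma incidence_connectedI:
  assumes "\<And>y. y \<in> S \<Longrightarrow> (x, y) \<in> {(u, v). u \<in> S \<and> v \<in> S \<and> incident L u v}\<^sup>*"
  shows "incidence_connected L S"
proof -
  have "sym {(u, v). u \<in> S \<and> v \<in> S \<and> incident L u v}"
    by (auto simp: sym_def incident_commute)
  then show ?thesis
    unfolding incidence_connected_def using assms sym_rtrancl by (meson rtrancl_trans symD)
qed

section \<open>The coset polyhedron of a rotation group\<close>

locale rotation_group = group G for G :: "'a monoid" (structure) +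
  fixes s t :: 'a
  assumes s_closed [simp]: "s \<in> carrier G" and t_closed [simp]: "t \<in> carrier G"
    and finite_carrier: "finite (carrier G)"
    and generated: "carrier G = generate G {s, t}"
    and involution: "s \<otimes> t \<otimes> (s \<otimes> t) = \<one>"
    and trivial_inter: "generate G {s} \<inter> generate G {t} = {\<one>}"
    and s_nontrivial: "s \<noteq> \<one>" and t_nontrivial: "t \<noteq> \<one>"
begin

text \<open>The stabilisers of the vertex, edge and face of the base flag.\<close>

definition stab :: "nat \<Rightarrow> 'a set" where
  "stab i = generate G {if i = 0 then t else if i = 1 then s \<otimes> t else s}"

lemma subgroup_stab: "subgroup (stab i) G"
  unfolding stab_def by (rule generate_is_subgroup) simp

lemma stab_closed: "h \<in> stab i \<Longrightarrow> h \<in> carrier G"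
  using subgroup.mem_carrier[OF subgroup_stab] .

lemma one_in_stab: "\<one> \<in> stab i"
  using subgroup.one_closed[OF subgroup_stab] .

lemma generators_in_stab: "t \<in> stab 0" "s \<otimes> t \<in> stab 1" "s \<in> stab 2"
  by (simp_all add: stab_def generate.incl)

lemma stab_1: "stab 1 = {\<one>, s \<otimes> t}"
proof
  have "subgroup {\<one>, s \<otimes> t} G"
    using involution inv_equality[OF involution] by (intro subgroupI) auto
  then show "stab 1 \<subseteq> {\<one>, s \<otimes> t}"
    unfolding stab_def by (intro generate_subgroup_incl) auto
qed (use one_in_stab generators_in_stab in auto)

lemma st_notin_stab: "s \<otimes> t \<notin> stab 0" "s \<otimes> t \<notin> stab 2"
proof -
  have "s = s \<otimes> t \<otimes> inv t" "t = inv s \<otimes> (s \<otimes> t)" by (simp_all add: m_assoc inv_m_cancel)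
  moreover have "s \<otimes> t \<otimes> inv t \<in> stab 0" if "s \<otimes> t \<in> stab 0"
    using that generators_in_stab(1) subgroup_stab
    by (blast intro: subgroup.m_closed subgroup.m_inv_closed)
  moreover have "inv s \<otimes> (s \<otimes> t) \<in> stab 2" if "s \<otimes> t \<in> stab 2"
    using that generators_in_stab(3) subgroup_stab
    by (blast intro: subgroup.m_closed subgroup.m_inv_closed)
  moreover have "stab 2 \<inter> stab 0 = {\<one>}" using trivial_inter by (simp add: stab_def)
  ultimately show "s \<otimes> t \<notin> stab 0" "s \<otimes> t \<notin> stab 2"
    using generators_in_stab s_nontrivial t_nontrivial by (metis IntI singletonD)+
qed

lemma stab_inter:
  assumes "i \<le> 2" "j \<le> 2" "i \<noteq> j"
  shows "stab i \<inter> stab j = {\<one>}"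
proof -
  have "stab 1 \<inter> stab 0 = {\<one>}" "stab 1 \<inter> stab 2 = {\<one>}"
    unfolding stab_1 using st_notin_stab one_in_stab by auto
  moreover have "stab 2 \<inter> stab 0 = {\<one>}" using trivial_inter by (simp add: stab_def)
  moreover have "i \<in> {0, 1, 2}" "j \<in> {0, 1, 2}" using assms by auto
  ultimately show ?thesis using assms(3) by (auto simp: Int_commute)
qed

lemma card_stab: "card (stab 0) = ord t" "card (stab 1) = 2" "card (stab 2) = ord s"
proof -
  have "\<one> \<noteq> s \<otimes> t" using st_notin_stab(1) one_in_stab by metis
  then show "card (stab 1) = 2" unfolding stab_1 by simp
qed (simp_all add: stab_def generate_pow_card)

lemma carrier_induct [consumes 1, case_names one s t]:
  assumes "x \<in> carrier G" "P \<one>"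
    and "\<And>x. x \<in> carrier G \<Longrightarrow> P x \<Longrightarrow> P (s \<otimes> x)" "\<And>x. x \<in> carrier G \<Longrightarrow> P x \<Longrightarrow> P (t \<otimes> x)"
  shows "P x"
proof (rule generate_induct_left[of "{s, t}" x])
  show "x \<in> generate G {s, t}" using assms(1) generated by simp
  show "ord a \<noteq> 0" if "a \<in> {s, t}" for a
    using ord_ge_1[OF finite_carrier, of a] that by auto
qed (use assms generated in auto)

definition element :: "nat \<Rightarrow> 'a \<Rightarrow> nat" where
  "element i x = 3 * to_nat_on (Pow (carrier G)) (stab i #> x) + i"

lemma element_mod: "i \<le> 2 \<Longrightarrow> element i x mod 3 = i"
  by (simp add: element_def)

lemma element_eq_iff:
  assumes "x \<in> carrier G" "y \<in> carrier G" "i \<le> 2" "j \<le> 2"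
  shows "element i x = element j y \<longleftrightarrow> i = j \<and> (\<exists>h\<in>stab i. y = h \<otimes> x)"
proof (cases "i = j")
  case True
  have "countable (Pow (carrier G))" using finite_carrier by (simp add: countable_finite)
  moreover have "stab i #> x \<in> Pow (carrier G)" "stab i #> y \<in> Pow (carrier G)"
    using assms r_coset_subset_G[OF subgroup.subset[OF subgroup_stab]] by auto
  ultimately have "element i x = element j y \<longleftrightarrow> stab i #> x = stab i #> y"
    using to_nat_on_inj by (simp add: element_def True)
  also have "\<dots> \<longleftrightarrow> y \<in> stab i #> x"
    using assms repr_independence repr_independenceD subgroup_stab by metis
  finally show ?thesis by (auto simp: r_coset_def True)
next
  case False
  then show ?thesis using element_mod[OF assms(3), of x] element_mod[OF assms(4), of y] by metis
qed

lemma element_stab_mult: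
  assumes "h \<in> stab i" "x \<in> carrier G" "i \<le> 2"
  shows "element i (h \<otimes> x) = element i x"
  using assms stab_closed element_eq_iff[of x "h \<otimes> x" i i] by force

lemma element_generator_mult:
  assumes "x \<in> carrier G"
  shows "element 0 (t \<otimes> x) = element 0 x" "element 1 (s \<otimes> (t \<otimes> x)) = element 1 x"
    "element 2 (s \<otimes> x) = element 2 x"
  using assms element_stab_mult generators_in_stab by (simp_all add: m_assoc[symmetric])

lemma vertex_face_determine:
  assumes "x \<in> carrier G" "y \<in> carrier G" "element 0 x = element 0 y" "element 2 x = element 2 y"
  shows "x = y"
proof -
  obtain h k where h: "h \<in> stab 0" "y = h \<otimes> x" and k: "k \<in> stab 2" "y = k \<otimes> x"
    using assms element_eq_iff by force
  then have "h = k" using assms stab_closed by (metis right_cancel)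
  then have "k = \<one>" using h(1) k(1) stab_inter[of 0 2] by auto
  then show ?thesis using k(2) assms(1) by simp
qed

definition coset_polyhedron :: "nat ranked_poset" where
  "coset_polyhedron =
     \<lparr>elems = {element i x | i x. i \<le> 2 \<and> x \<in> carrier G},
      order_rel = {(element i x, element j x) | i j x. i \<le> j \<and> j \<le> 2 \<and> x \<in> carrier G},
      rank = (\<lambda>n. n mod 3)\<rparr>"

abbreviation K where "K \<equiv> coset_polyhedron"

lemma elems_K: "elems K = {element i x | i x. i \<le> 2 \<and> x \<in> carrier G}"
  and rank_K: "rank K n = n mod 3"
  by (simp_all add: coset_polyhedron_def)

lemma element_in_elems: "i \<le> 2 \<Longrightarrow> x \<in> carrier G \<Longrightarrow> element i x \<in> elems K"
  by (auto simp: elems_K)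

lemma of_rank_K: "i \<le> 2 \<Longrightarrow> of_rank K i = element i ` carrier G"
  by (auto simp: of_rank_def elems_K rank_K element_mod)

lemma order_K_iff: "(m, n) \<in> order_rel K \<longleftrightarrow>
    (\<exists>i j x. m = element i x \<and> n = element j x \<and> i \<le> j \<and> j \<le> 2 \<and> x \<in> carrier G)"
  by (auto simp: coset_polyhedron_def)

lemma incident_iff:
  assumes "x \<in> carrier G" "y \<in> carrier G" "i \<le> 2" "j \<le> 2"
  shows "incident K (element i x) (element j y) \<longleftrightarrow> (\<exists>h\<in>stab i. element j y = element j (h \<otimes> x))"
proof
  assume "incident K (element i x) (element j y)"
  then obtain i' j' z where z: "z \<in> carrier G" "element i x = element i' z"
    "element j y = element j' z"
    and "i' \<le> 2" "j' \<le> 2"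
    by (auto simp: incident_def order_K_iff)
  then have "j' = j" and "\<exists>h\<in>stab i. z = h \<otimes> x"
    using element_eq_iff[OF assms(1) z(1) assms(3)] element_eq_iff[OF assms(2) z(1) assms(4)]
    by auto
  then show "\<exists>h\<in>stab i. element j y = element j (h \<otimes> x)" using z(3) by auto
next
  assume "\<exists>h\<in>stab i. element j y = element j (h \<otimes> x)"
  then obtain h where h: "h \<in> stab i" "element j y = element j (h \<otimes> x)" by blast
  have "h \<otimes> x \<in> carrier G" "element i x = element i (h \<otimes> x)"
    using h(1) assms stab_closed element_stab_mult by simp_all
  then show "incident K (element i x) (element j y)"
    unfolding incident_def order_K_iff h(2) using assms(3,4) nat_le_linear[of i j] by metis
qed

lemma incident_element: "i \<le> 2 \<Longrightarrow> j \<le> 2 \<Longrightarrow> x \<in> carrier G \<Longrightarrow> incident K (element i x) (element j x)"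
  unfolding incident_def order_K_iff using nat_le_linear[of i j] by metis

lemma incident_elements:
  assumes "x \<in> carrier G" "i \<le> 2" "j \<le> 2"
  shows "{n \<in> of_rank K j. incident K (element i x) n} = (\<lambda>h. element j (h \<otimes> x)) ` stab i"
  using assms incident_iff[OF assms(1) _ assms(2,3)] stab_closed by (auto simp: of_rank_K)

lemma card_incident_elements:
  assumes "x \<in> carrier G" "i \<le> 2" "j \<le> 2" "i \<noteq> j"
  shows "card {n \<in> of_rank K j. incident K (element i x) n} = card (stab i)"
    and "card {n \<in> of_rank K j. incident K n (element i x)} = card (stab i)"
proof -
  have "inj_on (\<lambda>h. element j (h \<otimes> x)) (stab i)"
  proof (rule inj_onI)
    fix h h' assume h: "h \<in> stab i" "h' \<in> stab i" and "element j (h \<otimes> x) = element j (h' \<otimes> x)"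
    then obtain k where k: "k \<in> stab j" "h' \<otimes> x = k \<otimes> (h \<otimes> x)"
      using element_eq_iff[of "h \<otimes> x" "h' \<otimes> x" j j] assms stab_closed by auto
    then have "h' = k \<otimes> h" using h assms(1) stab_closed by (simp add: m_assoc[symmetric])
    then have "k = h' \<otimes> inv h" using h k stab_closed by (simp add: m_assoc)
    then have "k \<in> stab i" using h subgroup_stab
      by (simp add: subgroup.m_closed subgroup.m_inv_closed)
    then have "k = \<one>" using k(1) stab_inter[OF assms(2-4)] by blast
    then show "h = h'" using \<open>h' = k \<otimes> h\<close> h stab_closed by simp
  qed
  then show "card {n \<in> of_rank K j. incident K (element i x) n} = card (stab i)"
    unfolding incident_elements[OF assms(1-3)] by (rule card_image)
  then show "card {n \<in> of_rank K j. incident K n (element i x)} = card (stab i)"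
    by (simp only: incident_commute[of K _ "element i x"])
qed

lemma element_generator_inv_mult:
  assumes x: "x \<in> carrier G"
  shows "element 0 (inv t \<otimes> x) = element 0 x" "element 2 (inv s \<otimes> x) = element 2 x"
    "element 1 (inv t \<otimes> x) = element 1 (s \<otimes> x)"
  using x element_generator_mult(1)[of "inv t \<otimes> x"] element_generator_mult(2)[of "inv t \<otimes> x"]
    element_generator_mult(3)[of "inv s \<otimes> x"]
  by (simp_all add: inv_m_cancel)

lemma order_K_mod_less: "(m, n) \<in> order_rel K \<Longrightarrow> m \<noteq> n \<Longrightarrow> m mod 3 < n mod 3"
  by (auto simp: order_K_iff element_mod order.strict_iff_order)

lemma element_between:
  assumes "i \<le> j" "j \<le> k" "k \<le> 2" "h \<in> stab j" "x \<in> carrier G"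
  shows "\<exists>z\<in>carrier G. element i z = element i x \<and> element k z = element k (h \<otimes> x)"
proof -
  consider "i = j" | "j = k" | "i = 0" "j = 1" "k = 2" using assms(1-3) by linarith
  then show ?thesis
  proof cases
    case 1
    then show ?thesis using assms element_stab_mult[of h j x] stab_closed
      by (intro bexI[of _ "h \<otimes> x"]) auto
  next
    case 2
    then show ?thesis using assms element_stab_mult[of h j x] by (intro bexI[of _ x]) auto
  next
    case 3
    then have "h = \<one> \<or> h = s \<otimes> t" using assms(4) stab_1 by blast
    then show ?thesis
    proof
      assume "h = \<one>"
      then show ?thesis using assms(5) by auto
    next
      assume "h = s \<otimes> t"
      then show ?thesis
        using 3 assms(5) element_generator_mult
        by (intro bexI[of _ "t \<otimes> x"]) (simp_all add: m_assoc)
    qed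
  qed
qed

lemma partial_order_K: "partial_order_on (elems K) (order_rel K)"
proof -
  have field: "order_rel K \<subseteq> elems K \<times> elems K"
    by (fastforce simp: order_K_iff intro: element_in_elems)
  have "refl_on (elems K) (order_rel K)"
    by (auto simp: refl_on_def elems_K order_K_iff)
  moreover have "antisym (order_rel K)"
    by (rule antisymI) (metis order_K_mod_less less_asym)
  moreover have "trans (order_rel K)"
  proof (rule transI)
    fix l m n assume "(l, m) \<in> order_rel K" "(m, n) \<in> order_rel K"
    then obtain i j x j' k y where lm: "l = element i x" "m = element j x" "i \<le> j" "j \<le> 2"
      and mn: "m = element j' y" "n = element k y" "j' \<le> k" "k \<le> 2"
      and xy: "x \<in> carrier G" "y \<in> carrier G"
      by (auto simp: order_K_iff)
    then obtain h where "j' = j" "h \<in> stab j" "y = h \<otimes> x"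
      using element_eq_iff[of x y j j'] by auto
    then obtain z where "z \<in> carrier G" "element i z = l" "element k z = n"
      using element_between[of i j k h x] lm mn xy by auto
    then show "(l, n) \<in> order_rel K"
      unfolding order_K_iff using lm(3) mn(3,4) \<open>j' = j\<close> by (metis order_trans)
  qed
  ultimately show ?thesis using field by (simp add: partial_order_on_def preorder_on_def)
qed

lemma connected_K: "incidence_connected K (elems K)"
proof (rule incidence_connectedI)
  let ?r = "{(u, v). u \<in> elems K \<and> v \<in> elems K \<and> incident K u v}"
  have reach: "\<forall>i\<le>2. (element 0 \<one>, element i x) \<in> ?r\<^sup>*"
    if "(element 0 \<one>, element k x) \<in> ?r\<^sup>*" "k \<le> 2" "x \<in> carrier G" for k x
  proof (intro allI impI)
    fix i :: nat assume "i \<le> 2"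
    then have "(element k x, element i x) \<in> ?r"
      using that(2,3) by (simp add: element_in_elems incident_element)
    with that(1) show "(element 0 \<one>, element i x) \<in> ?r\<^sup>*" by (rule rtrancl.rtrancl_into_rtrancl)
  qed
  have "\<forall>i\<le>2. (element 0 \<one>, element i x) \<in> ?r\<^sup>*" if "x \<in> carrier G" for x
    using that
  proof (induction rule: carrier_induct)
    case one
    show ?case by (rule reach[of 0]) simp_all
  next
    case (s x)
    then have "(element 0 \<one>, element 2 (s \<otimes> x)) \<in> ?r\<^sup>*" by (simp add: element_generator_mult)
    then show ?case by (rule reach) (simp_all add: s(1))
  next
    case (t x)
    then have "(element 0 \<one>, element 0 (t \<otimes> x)) \<in> ?r\<^sup>*" by (simp add: element_generator_mult)
    then show ?case by (rule reach) (simp_all add: t(1))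
  qed
  then show "(element 0 \<one>, n) \<in> ?r\<^sup>*" if "n \<in> elems K" for n
    using that by (auto simp: elems_K)
qed

lemma neighbours_K:
  assumes "i \<le> 2" "x \<in> carrier G"
  shows "neighbours K (element i x) = {element j (h \<otimes> x) | j h. j \<le> 2 \<and> j \<noteq> i \<and> h \<in> stab i}"
proof -
  have "n \<in> neighbours K (element i x) \<longleftrightarrow>
      (\<exists>j h. n = element j (h \<otimes> x) \<and> j \<le> 2 \<and> j \<noteq> i \<and> h \<in> stab i)" for n
  proof
    assume "n \<in> neighbours K (element i x)"
    then obtain j y where n: "n = element j y" "j \<le> 2" "y \<in> carrier G" "n \<noteq> element i x"
      "incident K (element i x) n"
      by (auto simp: neighbours_def elems_K)
    then obtain h where h: "h \<in> stab i" "n = element j (h \<otimes> x)"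
      using incident_iff[of x y i j] assms by auto
    then have "j \<noteq> i" using n(4) element_stab_mult assms by blast
    then show "\<exists>j h. n = element j (h \<otimes> x) \<and> j \<le> 2 \<and> j \<noteq> i \<and> h \<in> stab i" using h n by blast
  next
    assume "\<exists>j h. n = element j (h \<otimes> x) \<and> j \<le> 2 \<and> j \<noteq> i \<and> h \<in> stab i"
    then obtain j h where "n = element j (h \<otimes> x)" "j \<le> 2" "j \<noteq> i" "h \<in> stab i" by blast
    then show "n \<in> neighbours K (element i x)"
      using assms stab_closed incident_iff[of x "h \<otimes> x" i j]
        element_eq_iff[of "h \<otimes> x" x j i] element_in_elems
      by (auto simp: neighbours_def)
  qed
  then show ?thesis by blast
qed

text \<open>Along a face (a vertex figure), successive vertices (faces) are linked by an edge.\<close>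

lemma edge_link:
  fixes i k :: nat
  assumes "i = 0 \<and> k = 2 \<and> a = t \<or> i = 2 \<and> k = 0 \<and> a = s" "y \<in> carrier G"
  shows "\<exists>z\<in>{y, a \<otimes> y}. incident K (element k y) (element 1 z) \<and>
    incident K (element 1 z) (element k (a \<otimes> y))"
proof -
  consider "i = 0" "k = 2" "a = t" | "i = 2" "k = 0" "a = s" using assms(1) by blast
  then show ?thesis
  proof cases
    case 1
    have "incident K (element 1 (s \<otimes> (t \<otimes> y))) (element 2 (s \<otimes> (t \<otimes> y)))"
      using assms(2) by (simp add: incident_element)
    then have "incident K (element 1 y) (element 2 (t \<otimes> y))"
      using assms(2) by (simp add: element_generator_mult del: One_nat_def)
    then show ?thesis using 1 assms(2) incident_element[of 2 1 y] by auto
  next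
    case 2
    have "incident K (element 0 (inv t \<otimes> y)) (element 1 (inv t \<otimes> y))"
      using assms(2) by (simp add: incident_element)
    then have "incident K (element 0 y) (element 1 (s \<otimes> y))"
      using assms(2) by (simp add: element_generator_inv_mult del: One_nat_def)
    then show ?thesis using 2 assms(2) incident_element[of 1 0 "s \<otimes> y"] by auto
  qed
qed

lemma connected_figure:
  fixes i k :: nat
  assumes ika: "i = 0 \<and> k = 2 \<and> a = t \<or> i = 2 \<and> k = 0 \<and> a = s" and x: "x \<in> carrier G"
  shows "incidence_connected K (neighbours K (element i x))"
proof (rule incidence_connectedI)
  let ?N = "neighbours K (element i x)"
  let ?r = "{(u, v). u \<in> ?N \<and> v \<in> ?N \<and> incident K u v}"
  have stab_i: "stab i = generate G {a}" and a: "a \<in> {s, t}" and ik: "i \<le> 2" "k \<le> 2" "k \<noteq> i" "1 \<noteq> i"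
    using ika by (auto simp: stab_def)
  have a_mult: "a \<otimes> h \<in> stab i" if "h \<in> stab i" for h
    using that unfolding stab_i by (simp add: generate.eng generate.incl)
  have mem: "element j (h \<otimes> x) \<in> ?N" if "j \<le> 2" "j \<noteq> i" "h \<in> stab i" for j h
    using that x ik by (auto simp: neighbours_K)
  have step: "(element k (h \<otimes> x), element k (a \<otimes> h \<otimes> x)) \<in> ?r\<^sup>*" if h: "h \<in> stab i" for h
  proof -
    have ah: "a \<otimes> h \<otimes> x = a \<otimes> (h \<otimes> x)" using h a x stab_closed by (auto simp: m_assoc)
    obtain z where z: "z \<in> {h \<otimes> x, a \<otimes> h \<otimes> x}" "incident K (element k (h \<otimes> x)) (element 1 z)"
      "incident K (element 1 z) (element k (a \<otimes> h \<otimes> x))"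
      unfolding ah using edge_link[OF ika, of "h \<otimes> x"] h x stab_closed by auto
    have "element 1 z \<in> ?N" using z(1) mem[of 1] ik h a_mult by auto
    then have "(element k (h \<otimes> x), element 1 z) \<in> ?r" "(element 1 z, element k (a \<otimes> h \<otimes> x)) \<in> ?r"
      using z mem ik h a_mult by simp_all
    then show ?thesis by (meson r_into_rtrancl rtrancl_trans)
  qed
  have conn: "(element k x, element k (h \<otimes> x)) \<in> ?r\<^sup>*" if "h \<in> generate G {a}" for h
  proof (rule generate_induct_left[OF _ _ that])
    show "ord b \<noteq> 0" if "b \<in> {a}" for b
      using ord_ge_1[OF finite_carrier, of b] that a by auto
    show "(element k x, element k (b \<otimes> h \<otimes> x)) \<in> ?r\<^sup>*"
      if "b \<in> {a}" "h \<in> generate G {a}" "(element k x, element k (h \<otimes> x)) \<in> ?r\<^sup>*" for b h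
      using that step[of h] by (auto simp: stab_i intro: rtrancl_trans)
  qed (use a x in auto)
  fix n assume "n \<in> ?N"
  then obtain j h where n: "n = element j (h \<otimes> x)" "j \<le> 2" "j \<noteq> i" "h \<in> stab i"
    using x ik by (auto simp: neighbours_K)
  have "(element k (h \<otimes> x), n) \<in> ?r"
    using n mem ik x stab_closed by (simp add: incident_element)
  then show "(element k x, n) \<in> ?r\<^sup>*"
    using conn n(4) by (auto simp: stab_i intro: rtrancl.rtrancl_into_rtrancl)
qed

lemma stab_1_mult_in_stab_2:
  assumes h: "h \<in> stab 0" and k: "k \<in> stab 1" and kh: "k \<otimes> h \<in> stab 2"
  shows "h = \<one> \<or> t \<otimes> h = \<one>"
proof -
  consider "k = \<one>" | "k = s \<otimes> t" using k unfolding stab_1 by blast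
  then show ?thesis
  proof cases
    case 1
    then show ?thesis using h kh stab_inter[of 0 2] stab_closed by auto
  next
    case 2
    have "inv s \<otimes> (s \<otimes> t \<otimes> h) \<in> stab 2"
      using kh generators_in_stab(3) subgroup_stab unfolding 2
      by (simp add: subgroup.m_closed subgroup.m_inv_closed)
    then have "t \<otimes> h \<in> stab 2" using h stab_closed by (simp add: m_assoc inv_m_cancel)
    moreover have "t \<otimes> h \<in> stab 0"
      using h generators_in_stab(1) subgroup_stab by (simp add: subgroup.m_closed)
    ultimately show ?thesis using stab_inter[of 0 2] by auto
  qed
qed

lemma vertex_face_edges:
  assumes x: "x \<in> carrier G"
  shows "{e \<in> of_rank K 1. incident K (element 0 x) e \<and> incident K e (element 2 x)}
    = {element 1 x, element 1 (s \<otimes> x)}" (is "?edges = _")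
proof
  show "?edges \<subseteq> {element 1 x, element 1 (s \<otimes> x)}"
  proof
    fix e assume "e \<in> ?edges"
    moreover have "{n \<in> of_rank K 1. incident K (element 0 x) n} = (\<lambda>h. element 1 (h \<otimes> x)) ` stab 0"
      using x by (simp add: incident_elements)
    ultimately obtain h where h: "h \<in> stab 0" "e = element 1 (h \<otimes> x)"
      and "incident K e (element 2 x)"
      by blast
    then obtain k where k: "k \<in> stab 1" "element 2 x = element 2 (k \<otimes> (h \<otimes> x))"
      using incident_iff[of "h \<otimes> x" x 1 2] x stab_closed by auto
    then obtain l where "l \<in> stab 2" "k \<otimes> (h \<otimes> x) = l \<otimes> x"
      using element_eq_iff[of x "k \<otimes> (h \<otimes> x)" 2 2] h x stab_closed by auto
    then have "k \<otimes> h \<in> stab 2" using h k x stab_closed by (simp add: m_assoc[symmetric])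
    then consider "h = \<one>" | "t \<otimes> h = \<one>" using stab_1_mult_in_stab_2 h(1) k(1) by blast
    then show "e \<in> {element 1 x, element 1 (s \<otimes> x)}"
    proof cases
      case 1
      then show ?thesis using h x by simp
    next
      case 2
      then have "t \<otimes> (h \<otimes> x) = x" using h x stab_closed by (simp add: m_assoc[symmetric])
      then show ?thesis using element_generator_mult(2)[of "h \<otimes> x"] h x stab_closed by simp
    qed
  qed
  have "incident K (element 0 (inv t \<otimes> x)) (element 1 (inv t \<otimes> x))"
    "incident K (element 1 (s \<otimes> x)) (element 2 (s \<otimes> x))"
    using x by (simp_all add: incident_element)
  then show "{element 1 x, element 1 (s \<otimes> x)} \<subseteq> ?edges"
    using x incident_element[of _ _ x]
    by (auto simp: of_rank_K element_generator_mult element_generator_inv_mult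
        simp del: One_nat_def)
qed

lemma incident_vertex_face_common:
  assumes "v \<in> of_rank K 0" "f \<in> of_rank K 2" "incident K v f"
  shows "\<exists>x\<in>carrier G. v = element 0 x \<and> f = element 2 x"
proof -
  obtain a b where ab: "a \<in> carrier G" "b \<in> carrier G" "v = element 0 a" "f = element 2 b"
    using assms by (auto simp: of_rank_K)
  then obtain h where "h \<in> stab 0" "f = element 2 (h \<otimes> a)"
    using assms(3) incident_iff[of a b 0 2] by auto
  then show ?thesis
    using ab element_stab_mult[of h 0 a] stab_closed by (intro bexI[of _ "h \<otimes> a"]) simp_all
qed

lemma edge_s_mult_neq: "x \<in> carrier G \<Longrightarrow> element 1 (s \<otimes> x) \<noteq> element 1 x"
proof
  assume x: "x \<in> carrier G" and "element 1 (s \<otimes> x) = element 1 x"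
  then obtain h where "h \<in> stab 1" "s \<otimes> x = h \<otimes> x"
    using element_eq_iff[of x "s \<otimes> x" 1 1] by auto
  then have "s \<in> stab 1" using x stab_closed by simp
  then show False using generators_in_stab(3) stab_inter[of 1 2] s_nontrivial by auto
qed

lemma polyhedron_K: "polyhedron K"
  unfolding polyhedron_def
proof (intro conjI ballI impI)
  show "partial_order_on (elems K) (order_rel K)" by (rule partial_order_K)
  show "elems K \<noteq> {}" by (auto simp: elems_K)
  show "rank K n \<in> {0, 1, 2}" if "n \<in> elems K" for n
    using that by (auto simp: elems_K rank_K element_mod)
  show "case z of (m, n) \<Rightarrow> m \<noteq> n \<longrightarrow> rank K m < rank K n" if "z \<in> order_rel K" for z
    using that order_K_mod_less by (auto simp: rank_K)
  show "card {v \<in> of_rank K 0. incident K v e} = 2" "card {f \<in> of_rank K 2. incident K e f} = 2"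
    if e: "e \<in> of_rank K 1" for e
  proof -
    obtain x where "x \<in> carrier G" "e = element 1 x" using e of_rank_K[of 1] by auto
    then show "card {v \<in> of_rank K 0. incident K v e} = 2"
      "card {f \<in> of_rank K 2. incident K e f} = 2"
      using card_incident_elements[of x 1] card_stab(2) by simp_all
  qed
  show "card {e \<in> of_rank K 1. incident K v e \<and> incident K e f} = 2"
    if vf: "v \<in> of_rank K 0" "f \<in> of_rank K 2" "incident K v f" for v f
  proof -
    obtain x where "x \<in> carrier G" "v = element 0 x" "f = element 2 x"
      using incident_vertex_face_common[OF vf] by blast
    then show ?thesis using vertex_face_edges[of x] edge_s_mult_neq[of x] by simp
  qed
  show "incidence_connected K (elems K)" by (rule connected_K)
  show "incidence_connected K (neighbours K n)" if "n \<in> of_rank K 0 \<union> of_rank K 2" for n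
    using that connected_figure[of 0 2 t] connected_figure[of 2 0 s] by (auto simp: of_rank_K)
qed

lemma has_type_K: "has_type K (ord s) (ord t)"
proof -
  have finite: "finite {n \<in> of_rank K 1. P n}" for P
    using finite_carrier of_rank_K[of 1] by simp
  show ?thesis
    unfolding has_type_def
  proof (intro conjI ballI finite)
    fix f assume "f \<in> of_rank K 2"
    then obtain x where "x \<in> carrier G" "f = element 2 x" using of_rank_K[of 2] by auto
    then show "card {e \<in> of_rank K 1. incident K e f} = ord s"
      using card_incident_elements(2)[of x 2 1] card_stab(3) by simp
  next
    fix v assume "v \<in> of_rank K 0"
    then obtain x where "x \<in> carrier G" "v = element 0 x" using of_rank_K[of 0] by auto
    then show "card {e \<in> of_rank K 1. incident K v e} = ord t"
      using card_incident_elements(1)[of x 0 1] card_stab(1) by simp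
  qed
qed

definition white_flag :: "'a \<Rightarrow> nat flag" where
  "white_flag x = (element 0 x, element 1 x, element 2 x)"

definition black_flag :: "'a \<Rightarrow> nat flag" where
  "black_flag x = (element 0 x, element 1 (s \<otimes> x), element 2 x)"

lemma flags_K: "flags K = white_flag ` carrier G \<union> black_flag ` carrier G"
proof (intro equalityI subsetI)
  fix \<Phi> assume "\<Phi> \<in> flags K"
  then obtain v e f where \<Phi>: "\<Phi> = (v, e, f)"
    and vef: "v \<in> of_rank K 0" "e \<in> of_rank K 1" "f \<in> of_rank K 2"
    "incident K v e" "incident K e f" "incident K v f"
    by (auto simp: flags_def)
  obtain x where x: "x \<in> carrier G" "v = element 0 x" "f = element 2 x"
    using incident_vertex_face_common[OF vef(1,3,6)] by blast
  then have "e \<in> {element 1 x, element 1 (s \<otimes> x)}"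
    using vertex_face_edges[OF x(1)] vef by blast
  then have "\<Phi> = white_flag x \<or> \<Phi> = black_flag x"
    using x by (auto simp: \<Phi> white_flag_def black_flag_def)
  then show "\<Phi> \<in> white_flag ` carrier G \<union> black_flag ` carrier G" using x(1) by blast
next
  fix \<Phi> assume "\<Phi> \<in> white_flag ` carrier G \<union> black_flag ` carrier G"
  then obtain x where x: "x \<in> carrier G" "\<Phi> = white_flag x \<or> \<Phi> = black_flag x" by blast
  have "element 0 x \<in> of_rank K 0" "element 2 x \<in> of_rank K 2"
    "incident K (element 0 x) (element 2 x)"
    using x(1) by (simp_all add: of_rank_K incident_element)
  then show "\<Phi> \<in> flags K"
    using vertex_face_edges[OF x(1)] x(2) unfolding flags_def white_flag_def black_flag_def by blast
qed

lemma white_flag_in_flags: "x \<in> carrier G \<Longrightarrow> white_flag x \<in> flags K"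
  and black_flag_in_flags: "x \<in> carrier G \<Longrightarrow> black_flag x \<in> flags K"
  by (simp_all add: flags_K)

lemma inj_on_white_flag: "inj_on white_flag (carrier G)"
  and inj_on_black_flag: "inj_on black_flag (carrier G)"
  by (auto simp: inj_on_def white_flag_def black_flag_def intro: vertex_face_determine)

lemma white_flag_neq_black_flag:
  assumes "x \<in> carrier G" "y \<in> carrier G"
  shows "white_flag x \<noteq> black_flag y"
proof
  assume eq: "white_flag x = black_flag y"
  then have "x = y"
    using assms by (auto simp: white_flag_def black_flag_def intro: vertex_face_determine)
  then show False using eq edge_s_mult_neq[of y] assms by (simp add: white_flag_def black_flag_def)
qed

lemma card_flags_K: "card (flags K) = 2 * order G" and finite_flags_K: "finite (flags K)"
proof -
  have "white_flag ` carrier G \<inter> black_flag ` carrier G = {}"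
    using white_flag_neq_black_flag by blast
  then show "card (flags K) = 2 * order G"
    using finite_carrier inj_on_white_flag inj_on_black_flag
    by (simp add: flags_K card_Un_disjoint card_image order_def)
qed (simp add: flags_K finite_carrier)

lemma adjacent_flags_white_flag:
  assumes x: "x \<in> carrier G"
  shows "adjacent_flags 0 (white_flag x) (black_flag (inv s \<otimes> x))"
    and "adjacent_flags 1 (white_flag x) (black_flag x)"
    and "adjacent_flags 2 (white_flag x) (black_flag (t \<otimes> x))"
proof -
  have "element 0 (inv s \<otimes> x) \<noteq> element 0 x"
    using vertex_face_determine[of "inv s \<otimes> x" x] x s_nontrivial
      element_generator_inv_mult(2)[OF x] by auto
  then show "adjacent_flags 0 (white_flag x) (black_flag (inv s \<otimes> x))"
    using x by (simp add: adjacent_flags_def white_flag_def black_flag_def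
        element_generator_inv_mult inv_m_cancel)
  have "element 2 (t \<otimes> x) \<noteq> element 2 x"
    using vertex_face_determine[of "t \<otimes> x" x] x t_nontrivial element_generator_mult(1)[OF x] by auto
  then show "adjacent_flags 2 (white_flag x) (black_flag (t \<otimes> x))"
    using x element_generator_mult[OF x]
    by (simp add: adjacent_flags_def white_flag_def black_flag_def)
  show "adjacent_flags 1 (white_flag x) (black_flag x)"
    using edge_s_mult_neq[OF x] by (simp add: adjacent_flags_def white_flag_def black_flag_def)
qed

lemma adj_flag_white_flag:
  assumes "x \<in> carrier G"
  shows "adj_flag K 0 (white_flag x) = black_flag (inv s \<otimes> x)"
    and "adj_flag K 1 (white_flag x) = black_flag x"
    and "adj_flag K 2 (white_flag x) = black_flag (t \<otimes> x)"
  using assms adjacent_flags_white_flag[OF assms]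
  by (auto intro!: adj_flag_eqI polyhedron_K white_flag_in_flags black_flag_in_flags)

lemma adj_flag_black_flag:
  assumes x: "x \<in> carrier G"
  shows "adj_flag K 0 (black_flag x) = white_flag (s \<otimes> x)"
    and "adj_flag K 1 (black_flag x) = white_flag x"
    and "adj_flag K 2 (black_flag x) = white_flag (inv t \<otimes> x)"
  using x adjacent_flags_white_flag(1)[of "s \<otimes> x"] adjacent_flags_white_flag(2)[of x]
    adjacent_flags_white_flag(3)[of "inv t \<otimes> x"]
  by (auto intro!: adj_flag_eqI polyhedron_K white_flag_in_flags black_flag_in_flags
      intro: adjacent_flags_sym simp: inv_m_cancel)

lemma flag_image_generator_mult:
  assumes g: "g \<in> carrier (aut_group K)" and x: "x \<in> carrier G"
  shows "flag_image g (white_flag (s \<otimes> x)) =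
      adj_flag K 0 (adj_flag K 1 (flag_image g (white_flag x)))"
    and "flag_image g (white_flag (t \<otimes> x)) =
      adj_flag K 1 (adj_flag K 2 (flag_image g (white_flag x)))"
proof -
  have "white_flag (s \<otimes> x) = adj_flag K 0 (adj_flag K 1 (white_flag x))"
    "white_flag (t \<otimes> x) = adj_flag K 1 (adj_flag K 2 (white_flag x))"
    "adj_flag K 1 (white_flag x) \<in> flags K" "adj_flag K 2 (white_flag x) \<in> flags K"
    using x by (simp_all only: adj_flag_white_flag adj_flag_black_flag black_flag_in_flags
        m_closed t_closed)
  then show "flag_image g (white_flag (s \<otimes> x)) =
      adj_flag K 0 (adj_flag K 1 (flag_image g (white_flag x)))"
    "flag_image g (white_flag (t \<otimes> x)) =
      adj_flag K 1 (adj_flag K 2 (flag_image g (white_flag x)))"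
    using flag_image_adj_flag[OF polyhedron_K g] white_flag_in_flags[OF x] by simp_all
qed

lemma aut_eqI:
  assumes g: "g \<in> carrier (aut_group K)" and g': "g' \<in> carrier (aut_group K)"
    and base: "flag_image g (white_flag \<one>) = flag_image g' (white_flag \<one>)"
  shows "g = g'"
proof (rule extensionalityI)
  show "g \<in> extensional (elems K)" "g' \<in> extensional (elems K)"
    using g g' by (simp_all add: aut_group_def Bij_def)
  fix n assume "n \<in> elems K"
  then obtain i x where n: "n = element i x" "i \<le> 2" and "x \<in> carrier G" by (auto simp: elems_K)
  from \<open>x \<in> carrier G\<close> have "flag_image g (white_flag x) = flag_image g' (white_flag x)"
    by (induction rule: carrier_induct)
      (simp_all add: base flag_image_generator_mult[OF g] flag_image_generator_mult[OF g'])
  moreover have "i = 0 \<or> i = 1 \<or> i = 2" using n(2) by auto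
  ultimately show "g n = g' n" by (auto simp: n(1) white_flag_def)
qed

section \<open>Automorphisms by right multiplication\<close>

definition act :: "'a \<Rightarrow> nat \<Rightarrow> nat" where
  "act g = (\<lambda>n\<in>elems K. element (n mod 3) (inv_into (carrier G) (element (n mod 3)) n \<otimes> g))"

lemma act_element:
  assumes x: "x \<in> carrier G" and g: "g \<in> carrier G" and i: "i \<le> 2"
  shows "act g (element i x) = element i (x \<otimes> g)"
proof -
  define y where "y = inv_into (carrier G) (element i) (element i x)"
  have y: "y \<in> carrier G" "element i y = element i x"
    using x by (simp_all add: y_def inv_into_into f_inv_into_f)
  then obtain h where "h \<in> stab i" "x = h \<otimes> y" using element_eq_iff[of y x i i] x i by auto
  then have "element i (x \<otimes> g) = element i (y \<otimes> g)"
    using element_stab_mult[of h i "y \<otimes> g"] y g i stab_closed by (simp add: m_assoc)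
  then show ?thesis using x i by (simp add: act_def element_in_elems element_mod y_def)
qed

lemma act_in_elems:
  assumes "n \<in> elems K" "g \<in> carrier G"
  shows "act g n \<in> elems K"
proof -
  obtain i x where "n = element i x" "i \<le> 2" "x \<in> carrier G" using assms(1) by (auto simp: elems_K)
  then show ?thesis using assms(2) by (simp add: act_element element_in_elems)
qed

lemma act_act:
  "n \<in> elems K \<Longrightarrow> g \<in> carrier G \<Longrightarrow> h \<in> carrier G \<Longrightarrow> act h (act g n) = act (g \<otimes> h) n"
  by (auto simp: elems_K act_element m_assoc)

lemma act_one: "n \<in> elems K \<Longrightarrow> act \<one> n = n"
  by (auto simp: elems_K act_element)

lemma act_order: "(m, n) \<in> order_rel K \<Longrightarrow> g \<in> carrier G \<Longrightarrow> (act g m, act g n) \<in> order_rel K"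
  by (fastforce simp: order_K_iff act_element)

lemma act_aut:
  assumes g: "g \<in> carrier G"
  shows "act g \<in> carrier (aut_group K)"
proof -
  have inv: "act (inv g) (act g n) = n" "act g (act (inv g) n) = n" if "n \<in> elems K" for n
    using that g by (simp_all add: act_act act_one)
  have "bij_betw (act g) (elems K) (elems K)"
    by (rule bij_betw_byWitness[of _ "act (inv g)"]) (use g inv act_in_elems in auto)
  moreover have "(m, n) \<in> order_rel K \<longleftrightarrow> (act g m, act g n) \<in> order_rel K"
    if "m \<in> elems K" "n \<in> elems K" for m n
    using act_order[of m n g] act_order[of "act g m" "act g n" "inv g"] g that inv by auto
  moreover have "act g \<in> extensional (elems K)" unfolding act_def by (rule restrict_extensional)
  ultimately show ?thesis by (simp add: aut_group_def Bij_def)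
qed

lemma flag_image_act:
  assumes "x \<in> carrier G" "g \<in> carrier G"
  shows "flag_image (act g) (white_flag x) = white_flag (x \<otimes> g)"
    and "flag_image (act g) (black_flag x) = black_flag (x \<otimes> g)"
  using assms by (simp_all add: white_flag_def black_flag_def act_element m_assoc)

lemma act_hom: "act \<in> hom G (aut_group K)"
proof (rule homI)
  fix g h assume "g \<in> carrier G" "h \<in> carrier G"
  then show "act (g \<otimes> h) = act g \<otimes>\<^bsub>aut_group K\<^esub> act h"
    by (intro extensionalityI[of _ "elems K"])
      (auto simp: aut_group_def compose_def act_act act_def[of "g \<otimes> h"] restrict_extensional)
qed (rule act_aut)

lemma inj_on_act: "inj_on act (carrier G)"
proof (rule inj_onI)
  fix g h assume "g \<in> carrier G" "h \<in> carrier G" "act g = act h"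
  then have "white_flag g = white_flag h"
    using flag_image_act(1)[of \<one> g] flag_image_act(1)[of \<one> h] by simp
  then show "g = h" using inj_on_white_flag \<open>g \<in> carrier G\<close> \<open>h \<in> carrier G\<close> by (auto dest: inj_onD)
qed

section \<open>Reflections and chirality\<close>

definition reflexible :: bool where
  "reflexible \<longleftrightarrow> (\<exists>\<rho>\<in>hom G G. \<rho> s = inv s \<and> \<rho> t = inv t)"

lemma flag_image_black_generator_mult:
  assumes g: "g \<in> carrier (aut_group K)" and x: "x \<in> carrier G" and y: "y \<in> carrier G"
    and eq: "flag_image g (white_flag x) = black_flag y"
  shows "flag_image g (white_flag (s \<otimes> x)) = black_flag (inv s \<otimes> y)"
    and "flag_image g (white_flag (t \<otimes> x)) = black_flag (inv t \<otimes> y)"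
  using y by (simp_all only: flag_image_generator_mult[OF g x] eq adj_flag_black_flag
      adj_flag_white_flag m_closed inv_closed t_closed)

lemma flag_image_white_black:
  assumes g: "g \<in> carrier (aut_group K)" and a: "a \<in> carrier G"
    and base: "flag_image g (white_flag \<one>) = black_flag a" and x: "x \<in> carrier G"
  shows "\<exists>y\<in>carrier G. flag_image g (white_flag x) = black_flag (y \<otimes> a)"
  using x
proof (induction rule: carrier_induct)
  case one
  show ?case using base a by (intro bexI[of _ \<one>]) simp_all
next
  case (s x)
  then obtain y where "y \<in> carrier G" "flag_image g (white_flag x) = black_flag (y \<otimes> a)" by blast
  then show ?case
    using s(1) a flag_image_black_generator_mult[OF g, of x "y \<otimes> a"]
    by (intro bexI[of _ "inv s \<otimes> y"]) (simp_all add: m_assoc)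
next
  case (t x)
  then obtain y where "y \<in> carrier G" "flag_image g (white_flag x) = black_flag (y \<otimes> a)" by blast
  then show ?case
    using t(1) a flag_image_black_generator_mult[OF g, of x "y \<otimes> a"]
    by (intro bexI[of _ "inv t \<otimes> y"]) (simp_all add: m_assoc)
qed

lemma reflexible_if_white_to_black:
  assumes g: "g \<in> carrier (aut_group K)" and a: "a \<in> carrier G"
    and base: "flag_image g (white_flag \<one>) = black_flag a"
  shows reflexible
proof -
  obtain \<rho> where \<rho>: "\<And>x. x \<in> carrier G \<Longrightarrow> \<rho> x \<in> carrier G"
    "\<And>x. x \<in> carrier G \<Longrightarrow> flag_image g (white_flag x) = black_flag (\<rho> x \<otimes> a)"
    using flag_image_white_black[OF g a base] by metis
  have \<rho>_eqI: "\<rho> x = y"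
    if "flag_image g (white_flag x) = black_flag (y \<otimes> a)" "x \<in> carrier G" "y \<in> carrier G" for x y
    using inj_onD[OF inj_on_black_flag, of "\<rho> x \<otimes> a" "y \<otimes> a"] \<rho>[OF that(2)] that a by simp
  have one: "\<rho> \<one> = \<one>" using base a by (intro \<rho>_eqI) simp_all
  have s: "\<rho> (s \<otimes> x) = inv s \<otimes> \<rho> x" and t: "\<rho> (t \<otimes> x) = inv t \<otimes> \<rho> x" if x: "x \<in> carrier G" for x
    using flag_image_black_generator_mult[OF g x _ \<rho>(2)[OF x]] x a \<rho>(1)[OF x]
    by (auto intro!: \<rho>_eqI simp: m_assoc)
  have "\<rho> \<in> hom G G"
  proof (rule homI)
    fix x y assume x: "x \<in> carrier G" and y: "y \<in> carrier G"
    from x show "\<rho> (x \<otimes> y) = \<rho> x \<otimes> \<rho> y"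
      by (induction rule: carrier_induct) (simp_all add: y one s t \<rho>(1) m_assoc)
  qed (rule \<rho>(1))
  moreover have "\<rho> s = inv s" "\<rho> t = inv t" using s[of \<one>] t[of \<one>] one by simp_all
  ultimately show ?thesis unfolding reflexible_def by blast
qed

lemma aut_is_act:
  assumes "\<not> reflexible" and g: "g \<in> carrier (aut_group K)"
  shows "g \<in> act ` carrier G"
proof -
  have "flag_image g (white_flag \<one>) \<in> flags K"
    using flag_image_in_flags[OF polyhedron_K g white_flag_in_flags[OF one_closed]] .
  then obtain a where a: "a \<in> carrier G"
    and "flag_image g (white_flag \<one>) = white_flag a \<or> flag_image g (white_flag \<one>) = black_flag a"
    by (auto simp: flags_K)
  then have "flag_image g (white_flag \<one>) = white_flag a"
    using reflexible_if_white_to_black[OF g a] assms(1) by blast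
  then have "g = act a" using a by (intro aut_eqI[OF g act_aut]) (simp_all add: flag_image_act)
  then show ?thesis using a by blast
qed

lemma flag_transitive_on_colour_classes:
  "flag_transitive_on K (white_flag ` carrier G)" "flag_transitive_on K (black_flag ` carrier G)"
proof -
  have "\<exists>g\<in>carrier (aut_group K). flag_image g (white_flag x) = white_flag y \<and>
      flag_image g (black_flag x) = black_flag y" if "x \<in> carrier G" "y \<in> carrier G" for x y
    using that
    by (intro bexI[OF _ act_aut[of "inv x \<otimes> y"]]) (simp_all add: flag_image_act inv_m_cancel)
  then show "flag_transitive_on K (white_flag ` carrier G)"
    "flag_transitive_on K (black_flag ` carrier G)"
    unfolding flag_transitive_on_def by blast+
qed

lemma adj_flag_changes_colour:
  assumes "\<Phi> \<in> flags K" "i \<in> {0, 1, 2}"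
  shows "\<Phi> \<in> white_flag ` carrier G \<longleftrightarrow> adj_flag K i \<Phi> \<in> black_flag ` carrier G"
proof -
  have disjoint: "white_flag ` carrier G \<inter> black_flag ` carrier G = {}"
    using white_flag_neq_black_flag by blast
  consider x where "x \<in> carrier G" "\<Phi> = white_flag x" | x where "x \<in> carrier G" "\<Phi> = black_flag x"
    using assms(1) by (auto simp: flags_K)
  then show ?thesis
  proof cases
    case (1 x)
    then have "adj_flag K i \<Phi> \<in> black_flag ` carrier G"
      using assms(2) adj_flag_white_flag[of x] by auto
    then show ?thesis using 1 by blast
  next
    case (2 x)
    then have "adj_flag K i \<Phi> \<in> white_flag ` carrier G"
      using assms(2) adj_flag_black_flag[of x] by auto
    then show ?thesis using 2 disjoint by blast
  qed
qed

lemma chiral_K: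
  assumes "\<not> reflexible"
  shows "chiral K"
proof -
  have "\<not> flag_transitive_on K (flags K)"
  proof
    assume "flag_transitive_on K (flags K)"
    then obtain g where "g \<in> carrier (aut_group K)" "flag_image g (white_flag \<one>) = black_flag \<one>"
      unfolding flag_transitive_on_def
      using white_flag_in_flags black_flag_in_flags one_closed by meson
    then show False using reflexible_if_white_to_black assms by blast
  qed
  moreover have "white_flag ` carrier G \<inter> black_flag ` carrier G = {}"
    using white_flag_neq_black_flag by blast
  ultimately show ?thesis
    unfolding chiral_def
    using polyhedron_K adj_flag_changes_colour flag_transitive_on_colour_classes one_closed
    by (intro conjI exI[of _ "white_flag ` carrier G"] exI[of _ "black_flag ` carrier G"])
      (auto simp: flags_K)
qed

lemma is_aut_group_of_K:
  assumes "\<not> reflexible"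
  shows "is_aut_group_of (G, s, t) K"
proof -
  have "act \<in> iso G (aut_group K)"
    using act_hom inj_on_act act_aut aut_is_act[OF assms] by (auto simp: iso_def bij_betw_def)
  moreover have "flag_image (act s) (white_flag \<one>) = adj_flag K 0 (adj_flag K 1 (white_flag \<one>))"
    "flag_image (act t) (white_flag \<one>) = adj_flag K 1 (adj_flag K 2 (white_flag \<one>))"
    using flag_image_generator_mult[OF act_aut[OF one_closed] one_closed]
    by (simp_all only: flag_image_act l_one r_one one_closed s_closed t_closed m_closed)
  ultimately show ?thesis
    using white_flag_in_flags[OF one_closed] by auto
qed

lemma not_reflexibleI:
  assumes rels: "Gamma_relations G s t p q i1 j1 i2 j2" and "\<not> int (ord s) dvd i1 + i2"
  shows "\<not> reflexible"
proof
  assume reflexible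
  then obtain \<rho> where "\<rho> \<in> hom G G" and \<rho>: "\<rho> s = inv s" "\<rho> t = inv t"
    unfolding reflexible_def by blast
  then interpret \<rho>: group_hom G G \<rho> by (simp add: group_hom_def group_hom_axioms_def is_group)
  interpret Gamma_relations G s t p q i1 j1 i2 j2 by (rule rels)
  have "s [^] i2 \<otimes> t [^] j2 = \<rho> (inv t \<otimes> s)"
    by (simp add: \<rho> t_mult_inv_s)
  also have "\<dots> = s [^] (- i1) \<otimes> t [^] (- j1)"
    by (simp add: inv_t_mult_s \<rho>.hom_int_pow \<rho> int_pow_inv int_pow_neg)
  finally have eq: "s [^] i2 \<otimes> t [^] j2 = s [^] (- i1) \<otimes> t [^] (- j1)" .
  have "s [^] (i1 + i2) = s [^] i1 \<otimes> (s [^] i2 \<otimes> t [^] j2) \<otimes> t [^] (- j2)"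
    by (simp add: int_pow_mult int_pow_neg m_assoc)
  also have "\<dots> = t [^] (- j1 - j2)"
    unfolding eq by (simp add: int_pow_neg int_pow_diff m_assoc inv_m_cancel)
  finally have "s [^] (i1 + i2) = t [^] (- j1 - j2)" .
  moreover have "s [^] (i1 + i2) \<in> generate G {s}" "t [^] (- j1 - j2) \<in> generate G {t}"
    by (auto simp: generate_pow)
  ultimately have "s [^] (i1 + i2) = \<one>" using trivial_inter by auto
  then show False using assms(2) by (simp add: int_pow_eq_id)
qed

theorem exists_tight_chiral_polyhedron:
  assumes "\<not> reflexible" and "carrier G \<subseteq> generate G {s} <#> generate G {t}"
  shows "\<exists>K :: nat ranked_poset. chiral K \<and> tight K (ord s) (ord t) \<and> is_aut_group_of (G, s, t) K"
proof -
  have subgroups: "subgroup (generate G {s}) G" "subgroup (generate G {t}) G"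
    by (simp_all add: generate_is_subgroup)
  have "generate G {s} <#> generate G {t} \<subseteq> carrier G"
    using subgroups by (intro set_mult_closed subgroup.subset)
  then have "order G = ord s * ord t"
    using assms(2) card_set_mult_of_trivial_inter[OF subgroups trivial_inter]
    by (simp add: order_def generate_pow_card)
  then have "tight K (ord s) (ord t)"
    using polyhedron_K has_type_K finite_flags_K card_flags_K by (simp add: tight_def)
  then show ?thesis using chiral_K is_aut_group_of_K assms(1) by blast
qed

end

section \<open>The mix\<close>

locale group_mix = A: group A + B: group B for A :: "'a monoid" and B :: "'b monoid" +
  fixes a1 a2 b1 b2 and G :: "('a \<times> 'b) monoid" (structure) and s t
  assumes closed: "a1 \<in> carrier A" "a2 \<in> carrier A" "b1 \<in> carrier B" "b2 \<in> carrier B"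
    and mix: "(A, a1, a2) \<diamondop> (B, b1, b2) = (G, s, t)"
begin

interpretation AB: group "A \<times>\<times> B"
  by (rule DirProd_group) unfold_locales

lemma mix_eq: "G = subgroup_generated (A \<times>\<times> B) {s, t}" "s = (a1, b1)" "t = (a2, b2)"
  using mix by auto

sublocale group G
  unfolding mix_eq by (rule AB.group_subgroup_generated)

lemma generators_closed: "s \<in> carrier G" "t \<in> carrier G"
  unfolding mix_eq
  using AB.subgroup_generated_subset_carrier_subset[of "{(a1, b1), (a2, b2)}"] closed
  by auto

lemma carrier_eq_generate: "carrier G = generate G {s, t}"
proof -
  have "carrier (subgroup_generated G {s, t}) = carrier G"
    using AB.subgroup_generated2[of "{s, t}"] by (simp add: mix_eq(1))
  then show ?thesis using generators_closed by (simp add: carrier_subgroup_generated)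
qed

lemma mix_int_pow:
  "s [^] (k::int) = (a1 [^]\<^bsub>A\<^esub> k, b1 [^]\<^bsub>B\<^esub> k)" "t [^] (k::int) = (a2 [^]\<^bsub>A\<^esub> k, b2 [^]\<^bsub>B\<^esub> k)"
  using generators_closed closed unfolding mix_eq
  by (simp_all add: AB.int_pow_subgroup_generated DirProd_int_pow A.is_group B.is_group)

lemma mix_inv: "inv s = (inv\<^bsub>A\<^esub> a1, inv\<^bsub>B\<^esub> b1)" "inv t = (inv\<^bsub>A\<^esub> a2, inv\<^bsub>B\<^esub> b2)"
  using generators_closed closed A.is_group B.is_group unfolding mix_eq by simp_all

lemma mix_one_mult: "\<one> = (\<one>\<^bsub>A\<^esub>, \<one>\<^bsub>B\<^esub>)" "x \<otimes> y = (fst x \<otimes>\<^bsub>A\<^esub> fst y, snd x \<otimes>\<^bsub>B\<^esub> snd y)"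
  by (simp_all add: mix_eq(1) mult_DirProd')

lemma Gamma_relations_mix:
  assumes "Gamma_relations A a1 a2 p q i1 j1 i2 j2" "Gamma_relations B b1 b2 p q i1 j1 i2 j2"
  shows "Gamma_relations G s t p q i1 j1 i2 j2"
proof -
  interpret A: Gamma_relations A a1 a2 p q i1 j1 i2 j2 by fact
  interpret B: Gamma_relations B b1 b2 p q i1 j1 i2 j2 by fact
  show ?thesis
    by (intro Gamma_relations.intro Gamma_relations_axioms.intro is_group generators_closed)
      (unfold mix_one_mult mix_inv mix_int_pow,
        simp_all add: mix_eq(2,3) A.s_pow A.t_pow A.st_involution A.inv_t_mult_s A.t_mult_inv_s
          B.s_pow B.t_pow B.st_involution B.inv_t_mult_s B.t_mult_inv_s)
qed

end

locale Gamma_mix =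
  fixes M :: int and A :: "gen word set monoid" and a1 a2 and B :: "gen word set monoid" and b1 b2
    and G :: "(gen word set \<times> gen word set) monoid" (structure) and s t
  assumes M_pos: "M > 0" and coprime_3_M: "coprime 3 M"
    and A: "Gamma (16 * M) (32 * M) (-1 + 8 * M) (-3 + 8 * M) (1 + 8 * M) (3 + 8 * M) = (A, a1, a2)"
    and B: "Gamma (32 * M) 8 (-1 + 8 * M) (-3) (1 + 8 * M) 3 = (B, b1, b2)"
    and mix: "(A, a1, a2) \<diamondop> (B, b1, b2) = (G, s, t)"
begin

interpretation A: Gamma_relations A a1 a2 "16 * M" "32 * M"
  "-1 + 8 * M" "-3 + 8 * M" "1 + 8 * M" "3 + 8 * M"
  using A by (rule Gamma_relations_Gamma)

interpretation B: Gamma_relations B b1 b2 "32 * M" 8 "-1 + 8 * M" "-3" "1 + 8 * M" 3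
  using B by (rule Gamma_relations_Gamma)

interpretation group_mix A B a1 a2 b1 b2 G s t
  by unfold_locales (simp_all add: mix del: mix.simps)

lemma Gamma_relations_G:
  "Gamma_relations G s t (32 * M) (32 * M) (-1 + 8 * M) (-3 + 8 * M) (1 + 8 * M) (3 + 8 * M)"
proof (rule Gamma_relations_mix)
  show "Gamma_relations A a1 a2 (32 * M) (32 * M) (-1 + 8 * M) (-3 + 8 * M) (1 + 8 * M) (3 + 8 * M)"
    by (rule A.Gamma_relations_cong) simp_all
  show "Gamma_relations B b1 b2 (32 * M) (32 * M) (-1 + 8 * M) (-3 + 8 * M) (1 + 8 * M) (3 + 8 * M)"
    by (rule B.Gamma_relations_cong) (simp_all add: cong_iff_dvd_diff)
qed

lemma powers_eq_imp_dvd: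
  assumes "s [^] i = t [^] j"
  shows "32 * M dvd i" "32 * M dvd j"
proof -
  have "a1 [^]\<^bsub>A\<^esub> i = a2 [^]\<^bsub>A\<^esub> j" "b1 [^]\<^bsub>B\<^esub> i = b2 [^]\<^bsub>B\<^esub> j"
    using assms by (simp_all add: mix_int_pow)
  then have "[face_action M i 0 = 0 + j] (mod 32 * M)" "[0 + i = vertex_action M j 0] (mod 32 * M)"
    using Gamma_model.Gamma_powers_eq_imp_cong[OF Gamma_model_face_action[OF M_pos] A]
      Gamma_model.Gamma_powers_eq_imp_cong[OF Gamma_model_vertex_action[OF M_pos] B] by blast+
  then show "32 * M dvd i" "32 * M dvd j"
    by (simp_all add: face_action_0 vertex_action_0 cong_0_iff cong_sym_eq[of 0])
qed

sublocale twisted_Gamma_relations G s t "32 * M" "32 * M" "8 * M"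
proof (intro twisted_Gamma_relations.intro twisted_Gamma_relations_axioms.intro Gamma_relations_G)
  have "coprime (3::int) (2 ^ 5)" by (simp only: coprime_power_right_iff) simp
  then show "coprime 3 (32 * M)" using coprime_3_M by simp
qed (use M_pos in simp_all)

lemma ord_s: "int (ord s) = 32 * M" and ord_t: "int (ord t) = 32 * M"
proof -
  have "32 * M dvd int (ord s)" "32 * M dvd int (ord t)"
    using powers_eq_imp_dvd(1)[of "int (ord s)" 0] powers_eq_imp_dvd(2)[of 0 "int (ord t)"]
    by (simp_all add: int_pow_int)
  moreover have "int (ord s) dvd 32 * M" "int (ord t) dvd 32 * M"
    using s_pow t_pow by (simp_all add: int_pow_eq_id)
  ultimately show "int (ord s) = 32 * M" "int (ord t) = 32 * M"
    using M_pos by (auto intro: zdvd_antisym_nonneg)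
qed

lemma carrier_factors: "carrier G \<subseteq> generate G {s} <#> generate G {t}"
  using generate_pair_factors carrier_eq_generate by simp

sublocale rotation_group G s t
proof unfold_locales
  have "finite (generate G {s})" "finite (generate G {t})"
    using ord_s ord_t M_pos generate_pow_card[OF s_closed] generate_pow_card[OF t_closed]
    by (auto intro!: card_ge_0_finite)
  then show "finite (carrier G)"
    using finite_subset[OF carrier_factors] by (simp add: set_mult_def)
  show "generate G {s} \<inter> generate G {t} = {\<one>}"
  proof (intro equalityI subsetI)
    fix x assume "x \<in> generate G {s} \<inter> generate G {t}"
    then obtain i j :: int where "x = s [^] i" "s [^] i = t [^] j" by (auto simp: generate_pow)
    then show "x \<in> {\<one>}" using powers_eq_imp_dvd(2)[of i j] by (simp add: int_pow_eq_id ord_t)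
  qed (simp add: generate.one)
  show "s \<noteq> \<one>" "t \<noteq> \<one>" using ord_s ord_t M_pos ord_id by auto
qed (fact carrier_eq_generate | simp add: st_involution)+

lemma not_reflexible_G: "\<not> reflexible"
proof (rule not_reflexibleI[OF Gamma_relations_G])
  show "\<not> int (ord s) dvd - 1 + 8 * M + (1 + 8 * M)"
    using M_pos by (auto simp: ord_s dest: zdvd_imp_le)
qed

end

theorem theorem3p12:
  fixes \<alpha> :: nat and \<Gamma>1 \<Gamma>2 :: "gen word set gen_group"
  assumes "\<alpha> \<ge> 5"
    and "\<Gamma>1 = Gamma (2 ^ (\<alpha> - 1)) (2 ^ \<alpha>)
                 (-1 + 2 ^ (\<alpha> - 2)) (-3 + 2 ^ (\<alpha> - 2)) (1 + 2 ^ (\<alpha> - 2)) (3 + 2 ^ (\<alpha> - 2))"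
    and "\<Gamma>2 = Gamma (2 ^ \<alpha>) 8 (-1 + 2 ^ (\<alpha> - 2)) (-3) (1 + 2 ^ (\<alpha> - 2)) 3"
  shows "\<exists>K :: nat ranked_poset.
           chiral K \<and> tight K (2 ^ \<alpha>) (2 ^ \<alpha>) \<and> is_aut_group_of (\<Gamma>1 \<diamondop> \<Gamma>2) K"
proof -
  define M :: int where "M = 2 ^ (\<alpha> - 5)"
  obtain n where n: "\<alpha> = n + 5" using assms(1) by (metis add.commute le_Suc_ex)
  have pows: "2 ^ (\<alpha> - 1) = 16 * M" "2 ^ \<alpha> = 32 * M" "2 ^ (\<alpha> - 2) = 8 * M"
    by (simp_all add: M_def n power_add numeral_eq_Suc)
  obtain A a1 a2 B b1 b2 where A: "\<Gamma>1 = (A, a1, a2)" and B: "\<Gamma>2 = (B, b1, b2)"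
    using prod_cases3 by metis
  obtain G s t where G: "\<Gamma>1 \<diamondop> \<Gamma>2 = (G, s, t)" using prod_cases3 by blast
  interpret Gamma_mix M A a1 a2 B b1 b2 G s t
  proof
    show "M > 0" "coprime 3 M" by (simp_all add: M_def)
    show "(A, a1, a2) \<diamondop> (B, b1, b2) = (G, s, t)" using G unfolding A B .
  qed (use A B in \<open>simp_all only: assms(2,3) pows\<close>)
  have "int (ord s) = int (2 ^ \<alpha>)" "int (ord t) = int (2 ^ \<alpha>)"
    using ord_s ord_t pows(2) by simp_all
  then have "ord s = 2 ^ \<alpha>" "ord t = 2 ^ \<alpha>" by (simp_all only: of_nat_eq_iff)
  then show ?thesis
    using exists_tight_chiral_polyhedron[OF not_reflexible_G carrier_factors] by (simp only: G)
qed

end
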